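(* Assume the separable-domain, separable-operator and separable-architecture setting described in the context, on the tensor-product collocation grid. Then the following hold. (1) The full residual Jacobian $\mathrm J_{\rho}=[\mathrm J_1\ \cdots\ \mathrm J_d]\in\mathbb R^{N_{\mathcal D}\times P}$ factorizes as $\mathrm J_\rho=\Psi\,\mathsf C$, where $\Psi:=[\Psi_1\ \cdots\ \Psi_d]\in\mathbb R^{N_{\mathcal D}\times N_{\mathrm{eff}}}$, $\mathsf C:=\operatorname{diag}(\mathsf C_1,\dots,\mathsf C_d)\in\mathbb R^{N_{\mathrm{eff}}\times P}$ (block diagonal), and $$N_{\mathrm{eff}}:=\sum_{s=1}^dN_s=R_{\mathcal A}\sum_{s=1}^dn_sk_s.$$ (2) Let $\Upsilon:=\frac1{N_{\mathcal D}}\Psi^\top\Psi=[\Upsilon_{st}]_{s,t=1}^d$ with $\Upsilon_{st}:=\frac1{N_{\mathcal D}}\Psi_s^\top\Psi_t\in\mathbb R^{N_s\times N_t}$. Each block is composed of operator-indexed blocks, $\Upsilon_{st}=[\Upsilon_{st}^{(\beta,\gamma)}]_{\beta,\gamma=1}^{R_{\mathcal A}}$ with $\Upsilon_{st}^{(\beta,\gamma)}=\frac1{N_{\mathcal D}}(\Psi_s^{(\beta)})^\top\Psi_t^{(\gamma)}\in\mathbb R^{n_sk_s\times n_tk_t}$. The discrete Gauss--Newton Gramian $\widehat{\mathrm G}:=\frac1{N_{\mathcal D}}\mathrm J_\rho^\top\mathrm J_\rho$, with blocks $\widehat{\mathrm G}_{st}=\frac1{N_{\mathcal D}}\mathrm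 J_s^\top\mathrm J_t$, satisfies $$\widehat{\mathrm G}=\mathsf C^\top\Upsilon\,\mathsf C,\qquad \widehat{\mathrm G}_{st}=\mathsf C_s^\top\Upsilon_{st}\mathsf C_t .$$ In particular $\operatorname{rank}(\widehat{\mathrm G})=\operatorname{rank}(\mathrm J_\rho)\le\min\{N_{\mathcal D},N_{\mathrm{eff}},P\}$. (3) Let $\rho_{\mathrm c}:=\frac1{N_{\mathcal D}}\Psi^\top\rho(\theta)\in\mathbb R^{N_{\mathrm{eff}}}$, which is the vertical stack of $\rho_{\mathrm c,s}:=\frac1{N_{\mathcal D}}\Psi_s^\top\rho(\theta)\in\mathbb R^{N_s}$, $s=1,\dots,d$; each $\rho_{\mathrm c,s}$ is in turn the vertical stack of $\rho_{\mathrm c,s}^{(\beta)}:=\frac1{N_{\mathcal D}}(\Psi_s^{(\beta)})^\top\rho(\theta)\in\mathbb R^{n_sk_s}$, $\beta=1,\dots,R_{\mathcal A}$. Then the discrete loss gradient satisfies $$\nabla\widehat{\mathcal L}(\theta)=\mathsf C^\top\rho_{\mathrm c},\qquad \nabla_{\theta^s}\widehat{\mathcal L}(\theta)=\mathsf C_s^\top\rho_{\mathrm c,s},\quad s=1,\dots,d.$$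
   Context: Domain: $d=d_x+d_\xi$; $\Omega=\mathcal D_1\times\cdots\times\mathcal D_{d_x}$, $\Xi=\mathcal D_{d_x+1}\times\cdots\times\mathcal D_d$, $\mathcal D=\Omega\times\Xi$, where $\mathcal D_m=(z_m^-,z_m^+)\subset\mathbb R$ are bounded open intervals. $L^2(\mathcal D)$ is identified with $\bigotimes_m L^2(\mathcal D_m)$; $v_1\otimes\cdots\otimes v_d$ is the function $\prod_m v_m(z_m)$. Operator: $V$ is a Hilbert space of functions on $\Omega$ with bounded trace $V\to L^2(\partial\Omega)$, $U=L^2(\Xi;V)$, $\mathcal A:U\to L^2(\mathcal D)$ bounded linear. There are Hilbert spaces $H_m\hookrightarrow L^2(\mathcal D_m)$ such that $H=H_1\otimes\cdots\otimes H_d$ (Hilbert tensor product) satisfies $\|v_1\otimes\cdots\otimes v_d\|_H=\prod_m\|v_m\|_{H_m}$, is continuously and densely embedded in $U$, and $\mathcal A|_H=\sum_{\beta=1}^{R_{\mathcal A}}\mathcal A_1^{(\beta)}\otimes\cdots\otimes\mathcal A_d^{(\beta)}$ with bounded linear $\mathcal A_m^{(\beta)}:H_m\to L^2(\mathcal D_m)$. Architecture: $\theta=(\theta^1,\dots,\theta^d)$, $\theta^m\in\mathbb R^{P_m}$, $P=\sum_mP_m$; differentiable maps $\mathbb R^{P_m}\to H_m^{k_m}$, $\theta^m\mapsto(w_m^1,\dots,w_m^{k_m})$; a fixed array $c\in\mathbb R^{k_1\times\cdots\times k_d}$; $u_\theta=\sum_{a_1,\dots,a_d}c_{a_1\ldots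 a_d}\,w_1^{a_1}\otimes\cdots\otimes w_d^{a_d}\in H$. Index convention: $\overline{i_1\ldots i_k}=i_k+(i_{k-1}-1)n_k+\cdots+(i_1-1)n_2\cdots n_k$ is the lexicographic position of $(i_1,\dots,i_k)$ (leftmost index slowest). Collocation: $\mathcal X_m=\{z_{m,1},\dots,z_{m,n_m}\}\subset\mathcal D_m$, $N_{\mathcal D}=\prod_mn_m$, and for $i=\overline{i_1\ldots i_d}$ put $z_i=(z_{1,i_1},\dots,z_{d,i_d})$. The functions $\mathcal A_m^{(\beta)}w_m^{a}$ and $\mathcal A_m^{(\beta)}\partial_{\theta^m_j}w_m^{a}$ are assumed to have continuous representatives on $\overline{\mathcal D_m}$, and $f\in L^2(\mathcal D)$ admits pointwise evaluation. The Jacobian blocks are $\mathrm J_s\in\mathbb R^{N_{\mathcal D}\times P_s}$, $\mathrm J_s(i,j)=(\mathcal A\partial_{\theta^s_j}u_\theta)(z_i)$. The residual vector is $\rho(\theta)\in\mathbb R^{N_{\mathcal D}}$, $\rho(\theta)_i=(\mathcal Au_\theta-f)(z_i)$; the discrete loss is $\widehat{\mathcal L}(\theta)=\frac1{2N_{\mathcal D}}\|\rho(\theta)\|_2^2$, with discrete gradient $\nabla\widehat{\mathcal L}(\theta)=\frac1{N_{\mathcal D}}\mathrm J_\rho^\top\rho(\theta)$ and blocks $\nabla_{\theta^s}\widehat{\mathcal L}(\theta)=\frac1{N_{\mathcal D}}\mathrm J_s^\top\rho(\theta)$. Factors: $i_{-s}$ (resp. $a_{-s}$) is $(i_1,\dots,i_d)$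 (resp. $(a_1,\dots,a_d)$) with the $s$-th entry removed, and $N_{-s}=\prod_{m\ne s}n_m$. For $\beta=1,\dots,R_{\mathcal A}$ set $$\mathsf E_s^{(\beta)}(\overline{i_{-s}},a_s)=\sum_{a_{-s}}c_{a_1\ldots a_d}\prod_{m\ne s}(\mathcal A_m^{(\beta)}w_m^{a_m})(z_{m,i_m}),\qquad \mathsf E_s^{(\beta)}\in\mathbb R^{N_{-s}\times k_s},$$ $$\mathsf C_s^{(\beta)}(\overline{i_sa_s},j)=(\mathcal A_s^{(\beta)}\partial_{\theta^s_j}w_s^{a_s})(z_{s,i_s}),\qquad \mathsf C_s^{(\beta)}\in\mathbb R^{n_sk_s\times P_s},$$ $$\Psi_s^{(\beta)}(i,\overline{j_sa_s})=\delta_{i_sj_s}\,\mathsf E_s^{(\beta)}(\overline{i_{-s}},a_s),\qquad \Psi_s^{(\beta)}\in\mathbb R^{N_{\mathcal D}\times n_sk_s},$$ and $\Psi_s=[\Psi_s^{(1)}\ \cdots\ \Psi_s^{(R_{\mathcal A})}]\in\mathbb R^{N_{\mathcal D}\times N_s}$, $\mathsf C_s$ = vertical stack of $\mathsf C_s^{(1)},\dots,\mathsf C_s^{(R_{\mathcal A})}$, in $\mathbb R^{N_s\times P_s}$, with $N_s=R_{\mathcal A}n_sk_s$. *)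

theory Defs
  imports "HOL-Analysis.Analysis" "Jordan_Normal_Form.DL_Rank"
begin

unbundle no inner_syntax
unbundle no vec_syntax

section \<open>Hilbert spaces of functions\<close>

text \<open>
  There are no quotients by almost-everywhere equality here: a space of classes is given by the set
  of all representatives (real-valued functions, whose values outside the underlying measure space
  are irrelevant) together with the inner product evaluated on representatives. Consequently
  the seminorm \<open>nrm\<close> is a norm only up to the equality \<open>eqv\<close> of the space, and
  operators act on representatives and are linear up to \<open>eqv\<close>.
\<close>

record 'a fspace =
  car :: "('a \<Rightarrow> real) set"
  ip :: "('a \<Rightarrow> real) \<Rightarrow> ('a \<Rightarrow> real) \<Rightarrow> real"

definition nrm :: "'a fspace \<Rightarrow> ('a \<Rightarrow> real) \<Rightarrow> real" where
  "nrm X f = sqrt (ip X f f)"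

definition eqv :: "'a fspace \<Rightarrow> ('a \<Rightarrow> real) \<Rightarrow> ('a \<Rightarrow> real) \<Rightarrow> bool" where
  "eqv X f g \<longleftrightarrow> nrm X (\<lambda>x. f x - g x) = 0"

definition hilbert_fspace :: "'a measure \<Rightarrow> 'a fspace \<Rightarrow> bool" where
  "hilbert_fspace M X \<longleftrightarrow>
     car X \<subseteq> borel_measurable M \<and>
     (\<forall>f\<in>car X. \<forall>g\<in>borel_measurable M. (AE x in M. f x = g x) \<longrightarrow> g \<in> car X) \<and>
     (\<lambda>x. 0) \<in> car X \<and>
     (\<forall>f\<in>car X. \<forall>g\<in>car X. (\<lambda>x. f x + g x) \<in> car X) \<and>
     (\<forall>r. \<forall>f\<in>car X. (\<lambda>x. r * f x) \<in> car X) \<and>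
     (\<forall>f\<in>car X. \<forall>g\<in>car X. ip X f g = ip X g f) \<and>
     (\<forall>f\<in>car X. \<forall>g\<in>car X. \<forall>h\<in>car X. ip X (\<lambda>x. f x + g x) h = ip X f h + ip X g h) \<and>
     (\<forall>r. \<forall>f\<in>car X. \<forall>g\<in>car X. ip X (\<lambda>x. r * f x) g = r * ip X f g) \<and>
     (\<forall>f\<in>car X. 0 \<le> ip X f f) \<and>
     (\<forall>f\<in>car X. ip X f f = 0 \<longleftrightarrow> (AE x in M. f x = 0)) \<and>
     (\<forall>F. (\<forall>n. F n \<in> car X) \<and>
          (\<forall>e>0. \<exists>n0. \<forall>m\<ge>n0. \<forall>n\<ge>n0. nrm X (\<lambda>x. F m x - F n x) < e) \<longrightarrow>
          (\<exists>f\<in>car X. (\<lambda>n. nrm X (\<lambda>x. F n x - f x)) \<longlonglongrightarrow> 0))"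

definition L2 :: "'a measure \<Rightarrow> 'a fspace" where
  "L2 M = \<lparr> car = {f \<in> borel_measurable M. integrable M (\<lambda>x. (f x)\<^sup>2)},
            ip = (\<lambda>f g. \<integral>x. f x * g x \<partial>M) \<rparr>"

definition bounded_lin :: "'a fspace \<Rightarrow> 'b fspace \<Rightarrow> (('a \<Rightarrow> real) \<Rightarrow> ('b \<Rightarrow> real)) \<Rightarrow> bool" where
  "bounded_lin X Y T \<longleftrightarrow>
     (\<forall>f\<in>car X. T f \<in> car Y) \<and>
     (\<forall>f\<in>car X. \<forall>g\<in>car X. eqv Y (T (\<lambda>x. f x + g x)) (\<lambda>y. T f y + T g y)) \<and>
     (\<forall>r. \<forall>f\<in>car X. eqv Y (T (\<lambda>x. r * f x)) (\<lambda>y. r * T f y)) \<and>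
     (\<exists>K. \<forall>f\<in>car X. nrm Y (T f) \<le> K * nrm X f)"

definition embedded :: "'a fspace \<Rightarrow> 'a fspace \<Rightarrow> bool" where
  "embedded X Y \<longleftrightarrow> car X \<subseteq> car Y \<and> (\<exists>K. \<forall>f\<in>car X. nrm Y f \<le> K * nrm X f)"

definition dense_in :: "'a fspace \<Rightarrow> 'a fspace \<Rightarrow> bool" where
  "dense_in X Y \<longleftrightarrow> (\<forall>u\<in>car Y. \<forall>e>0. \<exists>h\<in>car X. nrm Y (\<lambda>x. u x - h x) < e)"

text \<open>
  The Bochner space of square-integrable maps from \<open>N\<close> to \<open>V\<close>. Its elements are functions \<open>u\<close>
  of all variables, read as the map \<open>\<xi> \<mapsto> sl u \<xi>\<close>, where \<open>sl\<close> freezes the variable \<open>\<xi>\<close>. Strong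
  measurability is approximability by simple functions. The completion only serves to
  tolerate arbitrary values of \<open>\<xi> \<mapsto> nrm V (sl u \<xi>)\<close> on null sets.
\<close>

definition simple_into :: "'b measure \<Rightarrow> 'c fspace \<Rightarrow> ('b \<Rightarrow> 'c \<Rightarrow> real) \<Rightarrow> bool" where
  "simple_into N V s \<longleftrightarrow>
     (\<exists>(K::nat) B b. (\<forall>k<K. B k \<in> sets N \<and> b k \<in> car V) \<and>
        (\<forall>\<xi>\<in>space N. s \<xi> = (\<lambda>x. \<Sum>k<K. indicator (B k) \<xi> * b k x)))"

definition bochner_L2 ::
  "'b measure \<Rightarrow> (('a \<Rightarrow> real) \<Rightarrow> 'b \<Rightarrow> ('c \<Rightarrow> real)) \<Rightarrow> 'c fspace \<Rightarrow> 'a fspace" where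
  "bochner_L2 N sl V =
     \<lparr> car = {u. (AE \<xi> in N. sl u \<xi> \<in> car V) \<and>
                 (\<exists>s. (\<forall>n::nat. simple_into N V (s n)) \<and>
                      (AE \<xi> in N. (\<lambda>n. nrm V (\<lambda>x. s n \<xi> x - sl u \<xi> x)) \<longlonglongrightarrow> 0)) \<and>
                 integrable (completion N) (\<lambda>\<xi>. (nrm V (sl u \<xi>))\<^sup>2)},
       ip = (\<lambda>u v. \<integral>\<xi>. ip V (sl u \<xi>) (sl v \<xi>) \<partial>(completion N)) \<rparr>"

text \<open>Point evaluation of a class through its continuous representative on \<open>S\<close>.\<close>

definition cont_rep :: "'a::topological_space measure \<Rightarrow> 'a set \<Rightarrow> ('a \<Rightarrow> real) \<Rightarrow> ('a \<Rightarrow> real) \<Rightarrow> bool"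
  where "cont_rep M S g h \<longleftrightarrow> continuous_on S h \<and> (AE x in M. h x = g x)"

definition cont_eval :: "'a::topological_space measure \<Rightarrow> 'a set \<Rightarrow> ('a \<Rightarrow> real) \<Rightarrow> 'a \<Rightarrow> real" where
  "cont_eval M S g x = (SOME h. cont_rep M S g h) x"

text \<open>Differentiation of maps from \<open>\<real>\<^sup>p\<close>, given as \<open>carrier_vec p\<close>, into a function space.\<close>

definition vnorm :: "real Matrix.vec \<Rightarrow> real" where
  "vnorm v = sqrt (scalar_prod v v)"

definition frechet_differentiable_at ::
  "'a fspace \<Rightarrow> nat \<Rightarrow> (real Matrix.vec \<Rightarrow> 'a \<Rightarrow> real) \<Rightarrow> real Matrix.vec \<Rightarrow> bool" where
  "frechet_differentiable_at X p F \<theta> \<longleftrightarrow>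
     (\<exists>G. (\<forall>j<p. G j \<in> car X) \<and>
       (\<forall>e>0. \<exists>\<delta>>0. \<forall>\<eta>\<in>carrier_vec p. vnorm (\<eta> - \<theta>) < \<delta> \<longrightarrow>
          nrm X (\<lambda>x. F \<eta> x - F \<theta> x - (\<Sum>j<p. vec_index (\<eta> - \<theta>) j * G j x)) \<le> e * vnorm (\<eta> - \<theta>)))"

definition has_partial ::
  "'a fspace \<Rightarrow> nat \<Rightarrow> (real Matrix.vec \<Rightarrow> 'a \<Rightarrow> real) \<Rightarrow> real Matrix.vec \<Rightarrow> nat \<Rightarrow> ('a \<Rightarrow> real) \<Rightarrow> bool" where
  "has_partial X p F \<theta> j g \<longleftrightarrow> g \<in> car X \<and>
     ((\<lambda>t. nrm X (\<lambda>x. (F (\<theta> + t \<cdot>\<^sub>v unit_vec p j) x - F \<theta> x) / t - g x)) \<longlongrightarrow> 0) (at 0)"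

definition partial_deriv ::
  "'a fspace \<Rightarrow> nat \<Rightarrow> (real Matrix.vec \<Rightarrow> 'a \<Rightarrow> real) \<Rightarrow> real Matrix.vec \<Rightarrow> nat \<Rightarrow> ('a \<Rightarrow> real)" where
  "partial_deriv X p F \<theta> j = (SOME g. has_partial X p F \<theta> j g)"

section \<open>Tensor products\<close>

text \<open>Points of a product of \<open>d\<close> intervals are extensional functions on \<open>{..<d}\<close>.\<close>

definition tens :: "nat \<Rightarrow> (nat \<Rightarrow> real \<Rightarrow> real) \<Rightarrow> (nat \<Rightarrow> real) \<Rightarrow> real" where
  "tens d v = (\<lambda>z. \<Prod>m<d. v m (z m))"

text \<open>
  The Hilbert tensor product, realised inside \<open>L2 M\<close> (with \<open>M\<close> the product measure) by letting the
  elementary tensors be product functions. The identity for inner products gives in particular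
  the cross-norm identity \<open>nrm H (tens d v) = (\<Prod>m<d. nrm (Hm m) (v m))\<close>.
\<close>

definition hilbert_tensor_product ::
  "nat \<Rightarrow> (nat \<Rightarrow> real) measure \<Rightarrow> (nat \<Rightarrow> real fspace) \<Rightarrow> (nat \<Rightarrow> real) fspace \<Rightarrow> bool" where
  "hilbert_tensor_product d M Hm H \<longleftrightarrow>
     hilbert_fspace M H \<and> embedded H (L2 M) \<and>
     (\<forall>v. (\<forall>m<d. v m \<in> car (Hm m)) \<longrightarrow> tens d v \<in> car H) \<and>
     (\<forall>v w. (\<forall>m<d. v m \<in> car (Hm m) \<and> w m \<in> car (Hm m)) \<longrightarrow>
        ip H (tens d v) (tens d w) = (\<Prod>m<d. ip (Hm m) (v m) (w m))) \<and>
     (\<forall>h\<in>car H. \<forall>e>0. \<exists>(K::nat) b v. (\<forall>k<K. \<forall>m<d. v k m \<in> car (Hm m)) \<and>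
        nrm H (\<lambda>z. h z - (\<Sum>k<K. b k * tens d (v k) z)) < e)"

definition is_tensor_op ::
  "nat \<Rightarrow> (nat \<Rightarrow> real) measure \<Rightarrow> (nat \<Rightarrow> real fspace) \<Rightarrow> (nat \<Rightarrow> real) fspace \<Rightarrow>
   (nat \<Rightarrow> (real \<Rightarrow> real) \<Rightarrow> (real \<Rightarrow> real)) \<Rightarrow> (((nat \<Rightarrow> real) \<Rightarrow> real) \<Rightarrow> ((nat \<Rightarrow> real) \<Rightarrow> real)) \<Rightarrow> bool" where
  "is_tensor_op d M Hm H Am T \<longleftrightarrow>
     bounded_lin H (L2 M) T \<and>
     (\<forall>v. (\<forall>m<d. v m \<in> car (Hm m)) \<longrightarrow>
        eqv (L2 M) (T (tens d v)) (tens d (\<lambda>m. Am m (v m))))"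

section \<open>Multi-indices and block matrices\<close>

text \<open>
  All indices start at \<open>0\<close>: a multi-index for the sizes \<open>ns\<close> is a list of the same length with
  entries \<open>is ! m < ns ! m\<close>, and \<open>lex_pos\<close> is its lexicographic position (leftmost index
  slowest) among \<open>0, \<dots>, prod_list ns - 1\<close>.
\<close>

definition multi :: "nat list \<Rightarrow> nat list set" where
  "multi ns = {is. length is = length ns \<and> (\<forall>m<length ns. is ! m < ns ! m)}"

definition lex_pos :: "nat list \<Rightarrow> nat list \<Rightarrow> nat" where
  "lex_pos ns is = (\<Sum>m<length ns. is ! m * prod_list (drop (Suc m) ns))"

definition lex_dec :: "nat list \<Rightarrow> nat \<Rightarrow> nat list" where
  "lex_dec ns = the_inv_into (multi ns) (lex_pos ns)"

lemma multi_Nil: "multi [] = {[]}"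
  by (auto simp: multi_def)

lemma multi_Cons: "multi (n # ns) = {i # is |i is. i < n \<and> is \<in> multi ns}"
proof (intro Set.set_eqI iffI)
  fix x assume "x \<in> multi (n # ns)"
  then obtain i "is" where x: "x = i # is" "length is = length ns"
    and *: "\<forall>m<Suc (length ns). (i # is) ! m < (n # ns) ! m"
    by (cases x) (auto simp: multi_def)
  from * have "i < n" by (metis nth_Cons_0 zero_less_Suc)
  moreover from * have "\<forall>m<length ns. is ! m < ns ! m" by (metis Suc_less_eq nth_Cons_Suc)
  ultimately show "x \<in> {i # is |i is. i < n \<and> is \<in> multi ns}" using x by (auto simp: multi_def)
next
  fix x assume "x \<in> {i # is |i is. i < n \<and> is \<in> multi ns}"
  then show "x \<in> multi (n # ns)" by (auto simp: multi_def nth_Cons split: nat.splits)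
qed

lemma lex_pos_Nil: "lex_pos [] [] = 0"
  by (simp add: lex_pos_def)

lemma lex_pos_Cons: "lex_pos (n # ns) (i # is) = i * prod_list ns + lex_pos ns is"
  unfolding lex_pos_def by (simp add: sum.lessThan_Suc_shift del: sum.lessThan_Suc)

lemma bij_betw_lex_pos: "bij_betw (lex_pos ns) (multi ns) {..<prod_list ns}"
proof (induction ns)
  case Nil
  then show ?case by (simp add: bij_betw_def multi_Nil lex_pos_Nil lessThan_Suc)
next
  case (Cons n ns)
  let ?p = "prod_list ns"
  have lt: "lex_pos ns is < ?p" if "is \<in> multi ns" for "is"
    using Cons that by (auto simp: bij_betw_def)
  have "inj_on (lex_pos (n # ns)) (multi (n # ns))"
  proof (rule inj_onI)
    fix x y
    assume "x \<in> multi (n # ns)" "y \<in> multi (n # ns)" and eq: "lex_pos (n # ns) x = lex_pos (n # ns) y"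
    then obtain i "is" j js where x: "x = i # is" "is \<in> multi ns" and y: "y = j # js" "js \<in> multi ns"
      by (auto simp: multi_Cons)
    have e: "i * ?p + lex_pos ns is = j * ?p + lex_pos ns js" using eq x y by (simp add: lex_pos_Cons)
    have dv: "(a * p + r) div p = a" if "r < p" for a p r :: nat
    proof -
      have "p \<noteq> 0" using that by simp
      then show ?thesis using that by (simp add: div_mult_self3)
    qed
    have "i = j" using dv[OF lt[OF x(2)], of i] dv[OF lt[OF y(2)], of j] e by metis
    moreover from this e have "is = js"
      using Cons x y by (auto simp: bij_betw_def inj_on_def)
    ultimately show "x = y" using x y by simp
  qed
  moreover have "lex_pos (n # ns) ` multi (n # ns) = {..<prod_list (n # ns)}"
  proof (intro equalityI subsetI)
    fix r assume "r \<in> lex_pos (n # ns) ` multi (n # ns)"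
    then obtain i "is" where "i < n" "is \<in> multi ns" and r: "r = i * ?p + lex_pos ns is"
      by (auto simp: multi_Cons lex_pos_Cons)
    then have "r < i * ?p + ?p" using lt by simp
    also have "\<dots> = Suc i * ?p" by simp
    also have "\<dots> \<le> n * ?p" using \<open>i < n\<close> by (intro mult_le_mono1) simp
    finally show "r \<in> {..<prod_list (n # ns)}" by simp
  next
    fix r assume "r \<in> {..<prod_list (n # ns)}"
    then have r: "r < n * ?p" by simp
    then have p: "?p > 0" by (metis mult_0_right neq0_conv not_less_zero)
    have "r mod ?p \<in> lex_pos ns ` multi ns" using Cons p by (auto simp: bij_betw_def)
    then obtain "is" where i: "is \<in> multi ns" "lex_pos ns is = r mod ?p" by auto
    have "r div ?p < n" using r by (simp add: less_mult_imp_div_less)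
    then have "(r div ?p) # is \<in> multi (n # ns)" using i by (auto simp: multi_Cons)
    moreover have "lex_pos (n # ns) ((r div ?p) # is) = r" using i by (simp add: lex_pos_Cons)
    ultimately show "r \<in> lex_pos (n # ns) ` multi (n # ns)" by (metis imageI)
  qed
  ultimately show ?case by (simp add: bij_betw_def)
qed

definition omit :: "nat \<Rightarrow> 'x list \<Rightarrow> 'x list" where
  "omit s xs = take s xs @ drop (Suc s) xs"

definition hcat :: "nat \<Rightarrow> 'x mat list \<Rightarrow> 'x mat" where
  "hcat nr As = mat_of_cols nr (concat (map cols As))"

definition vcat :: "nat \<Rightarrow> 'x mat list \<Rightarrow> 'x mat" where
  "vcat nc As = mat_of_rows nc (concat (map rows As))"

definition vstack :: "'x Matrix.vec list \<Rightarrow> 'x Matrix.vec" where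
  "vstack vs = vec_of_list (concat (map list_of_vec vs))"

text \<open>The block matrix \<open>[B s t]\<close> whose block column \<open>t < q\<close> has width \<open>wd t\<close>.\<close>

definition block_matrix ::
  "nat \<Rightarrow> nat \<Rightarrow> (nat \<Rightarrow> nat) \<Rightarrow> (nat \<Rightarrow> nat) \<Rightarrow> (nat \<Rightarrow> nat \<Rightarrow> 'x mat) \<Rightarrow> 'x mat" where
  "block_matrix p q ht wd B =
     vcat (\<Sum>t<q. wd t) (map (\<lambda>s. hcat (ht s) (map (\<lambda>t. B s t) [0..<q])) [0..<p])"

definition mrank :: "real mat \<Rightarrow> nat" where
  "mrank A = vec_space.rank (dim_row A) A"

section \<open>The setting\<close>

record setting =
  dim_x :: nat
  dim_xi :: nat
  z_lo :: "nat \<Rightarrow> real"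
  z_hi :: "nat \<Rightarrow> real"
  sp_V :: "(nat \<Rightarrow> real) fspace"
  trace_V :: "((nat \<Rightarrow> real) \<Rightarrow> real) \<Rightarrow> ((nat \<Rightarrow> real) \<Rightarrow> real)"
  op_A :: "((nat \<Rightarrow> real) \<Rightarrow> real) \<Rightarrow> ((nat \<Rightarrow> real) \<Rightarrow> real)"
  sp_Hm :: "nat \<Rightarrow> real fspace"
  sp_H :: "(nat \<Rightarrow> real) fspace"
  rank_A :: nat  \<comment> \<open>the number of terms in the separable form of \<open>op_A\<close>\<close>
  op_Am :: "nat \<Rightarrow> nat \<Rightarrow> (real \<Rightarrow> real) \<Rightarrow> (real \<Rightarrow> real)"  \<comment> \<open>arguments: \<open>\<beta>\<close>, then \<open>m\<close>\<close>
  npar :: "nat \<Rightarrow> nat"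
  width :: "nat \<Rightarrow> nat"
  feat :: "nat \<Rightarrow> nat \<Rightarrow> real Matrix.vec \<Rightarrow> (real \<Rightarrow> real)"  \<comment> \<open>\<open>w\<close>; arguments: \<open>m\<close>, \<open>a\<close>, \<open>\<theta>\<close> of block \<open>m\<close>\<close>
  core :: "nat list \<Rightarrow> real"
  npts :: "nat \<Rightarrow> nat"
  pts :: "nat \<Rightarrow> nat \<Rightarrow> real"
  rhs :: "(nat \<Rightarrow> real) \<Rightarrow> real"

definition dim_z :: "setting \<Rightarrow> nat" where
  "dim_z S = dim_x S + dim_xi S"

definition leb1 :: "setting \<Rightarrow> nat \<Rightarrow> real measure" where
  "leb1 S m = restrict_space lborel {z_lo S m<..<z_hi S m}"

definition leb :: "setting \<Rightarrow> nat set \<Rightarrow> (nat \<Rightarrow> real) measure" where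
  "leb S I = PiM I (leb1 S)"

definition leb_D :: "setting \<Rightarrow> (nat \<Rightarrow> real) measure" where
  "leb_D S = leb S {..<dim_z S}"

definition leb_Omega :: "setting \<Rightarrow> (nat \<Rightarrow> real) measure" where
  "leb_Omega S = leb S {..<dim_x S}"

definition leb_Xi :: "setting \<Rightarrow> (nat \<Rightarrow> real) measure" where
  "leb_Xi S = leb S {dim_x S..<dim_z S}"

definition cl1 :: "setting \<Rightarrow> nat \<Rightarrow> real set" where
  "cl1 S m = {z_lo S m..z_hi S m}"

definition cl_box :: "setting \<Rightarrow> nat \<Rightarrow> (nat \<Rightarrow> real) set" where
  "cl_box S k = PiE {..<k} (cl1 S)"

text \<open>
  Surface measure on the boundary of the box: the sum, over the \<open>2 * dim_x S\<close> faces, of the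
  Lebesgue measure in the remaining variables.
\<close>

definition surf_Omega :: "setting \<Rightarrow> (nat \<Rightarrow> real) measure" where
  "surf_Omega S =
     (let B = PiM {..<dim_x S} (\<lambda>_. lborel) in
      measure_of (space B) (sets B)
        (\<lambda>E. \<Sum>m<dim_x S. \<Sum>b\<in>{z_lo S m, z_hi S m}.
           emeasure (distr (leb S ({..<dim_x S} - {m})) B (\<lambda>y. y(m := b))) E))"

lemma emeasure_surf_Omega:
  assumes "E \<in> sets (PiM {..<dim_x S} (\<lambda>_. lborel))"
  shows "emeasure (surf_Omega S) E =
    (\<Sum>m<dim_x S. \<Sum>b\<in>{z_lo S m, z_hi S m}.
       emeasure (distr (leb S ({..<dim_x S} - {m})) (PiM {..<dim_x S} (\<lambda>_. lborel)) (\<lambda>y. y(m := b))) E)"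
proof -
  let ?B = "PiM {..<dim_x S} (\<lambda>_. lborel) :: (nat \<Rightarrow> real) measure"
  let ?f = "\<lambda>E. \<Sum>m<dim_x S. \<Sum>b\<in>{z_lo S m, z_hi S m}.
       emeasure (distr (leb S ({..<dim_x S} - {m})) ?B (\<lambda>y. y(m := b))) E"
  have "countably_additive (sets ?B) ?f"
  proof (rule countably_additiveI)
    fix A :: "nat \<Rightarrow> (nat \<Rightarrow> real) set"
    assume A: "range A \<subseteq> sets ?B" "disjoint_family A"
    have "(\<Sum>i. ?f (A i)) = (\<Sum>m<dim_x S. \<Sum>b\<in>{z_lo S m, z_hi S m}. \<Sum>i.
       emeasure (distr (leb S ({..<dim_x S} - {m})) ?B (\<lambda>y. y(m := b))) (A i))"
      by (simp add: suminf_sum)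
    also have "\<dots> = ?f (\<Union>i. A i)"
      using A by (intro sum.cong refl suminf_emeasure) auto
    finally show "(\<Sum>i. ?f (A i)) = ?f (\<Union>i. A i)" .
  qed
  moreover have "positive (sets ?B) ?f" by (simp add: positive_def)
  ultimately show ?thesis
    using assms unfolding surf_Omega_def Let_def
    by (intro emeasure_measure_of_sigma sets.sigma_algebra_axioms)
qed

definition slice :: "setting \<Rightarrow> ((nat \<Rightarrow> real) \<Rightarrow> real) \<Rightarrow> (nat \<Rightarrow> real) \<Rightarrow> ((nat \<Rightarrow> real) \<Rightarrow> real)" where
  "slice S u \<xi> = (\<lambda>x. u (merge {..<dim_x S} {dim_x S..<dim_z S} (x, \<xi>)))"

definition sp_U :: "setting \<Rightarrow> (nat \<Rightarrow> real) fspace" where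
  "sp_U S = bochner_L2 (leb_Xi S) (slice S) (sp_V S)"

definition separable_domain :: "setting \<Rightarrow> bool" where
  "separable_domain S \<longleftrightarrow> (\<forall>m<dim_z S. z_lo S m < z_hi S m)"

text \<open>The last conjunct below: a trace restricts functions that are continuous up to the boundary.\<close>

definition bounded_trace :: "setting \<Rightarrow> bool" where
  "bounded_trace S \<longleftrightarrow>
     bounded_lin (sp_V S) (L2 (surf_Omega S)) (trace_V S) \<and>
     (\<forall>v\<in>car (sp_V S). \<forall>g. cont_rep (leb_Omega S) (cl_box S (dim_x S)) v g \<longrightarrow>
        (AE x in surf_Omega S. trace_V S v x = g x))"

definition separable_operator :: "setting \<Rightarrow> bool" where
  "separable_operator S \<longleftrightarrow>
     hilbert_fspace (leb_Omega S) (sp_V S) \<and> bounded_trace S \<and>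
     bounded_lin (sp_U S) (L2 (leb_D S)) (op_A S) \<and>
     (\<forall>m<dim_z S. hilbert_fspace (leb1 S m) (sp_Hm S m) \<and> embedded (sp_Hm S m) (L2 (leb1 S m))) \<and>
     hilbert_tensor_product (dim_z S) (leb_D S) (sp_Hm S) (sp_H S) \<and>
     embedded (sp_H S) (sp_U S) \<and> dense_in (sp_H S) (sp_U S) \<and>
     (\<forall>\<beta><rank_A S. \<forall>m<dim_z S. bounded_lin (sp_Hm S m) (L2 (leb1 S m)) (op_Am S \<beta> m)) \<and>
     (\<exists>T. (\<forall>\<beta><rank_A S. is_tensor_op (dim_z S) (leb_D S) (sp_Hm S) (sp_H S) (op_Am S \<beta>) (T \<beta>)) \<and>
          (\<forall>h\<in>car (sp_H S). eqv (L2 (leb_D S)) (op_A S h) (\<lambda>z. \<Sum>\<beta><rank_A S. T \<beta> h z)))"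

definition separable_architecture :: "setting \<Rightarrow> bool" where
  "separable_architecture S \<longleftrightarrow>
     (\<forall>m<dim_z S. \<forall>a<width S m. \<forall>\<eta>\<in>carrier_vec (npar S m).
        feat S m a \<eta> \<in> car (sp_Hm S m) \<and>
        frechet_differentiable_at (sp_Hm S m) (npar S m) (feat S m a) \<eta>)"

definition parameter :: "setting \<Rightarrow> (nat \<Rightarrow> real Matrix.vec) \<Rightarrow> bool" where
  "parameter S \<theta> \<longleftrightarrow> (\<forall>m<dim_z S. \<theta> m \<in> carrier_vec (npar S m))"

definition sizes :: "setting \<Rightarrow> (nat \<Rightarrow> nat) \<Rightarrow> nat list" where
  "sizes S f = map f [0..<dim_z S]"

definition net :: "setting \<Rightarrow> (nat \<Rightarrow> real Matrix.vec) \<Rightarrow> (nat \<Rightarrow> real) \<Rightarrow> real" where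
  "net S \<theta> = (\<lambda>z. \<Sum>a\<in>multi (sizes S (width S)).
      core S a * tens (dim_z S) (\<lambda>m. feat S m (a ! m) (\<theta> m)) z)"

definition d_net :: "setting \<Rightarrow> (nat \<Rightarrow> real Matrix.vec) \<Rightarrow> nat \<Rightarrow> nat \<Rightarrow> (nat \<Rightarrow> real) \<Rightarrow> real" where
  "d_net S \<theta> s j = partial_deriv (sp_H S) (npar S s) (\<lambda>\<eta>. net S (\<theta>(s := \<eta>))) (\<theta> s) j"

definition d_feat :: "setting \<Rightarrow> (nat \<Rightarrow> real Matrix.vec) \<Rightarrow> nat \<Rightarrow> nat \<Rightarrow> nat \<Rightarrow> real \<Rightarrow> real" where
  "d_feat S \<theta> m a j = partial_deriv (sp_Hm S m) (npar S m) (feat S m a) (\<theta> m) j"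

text \<open>
  \<open>rhs S\<close> admits pointwise evaluation: it is given as a function rather than a class,
  and its values at the collocation points are those of that function.
\<close>

definition collocation :: "setting \<Rightarrow> (nat \<Rightarrow> real Matrix.vec) \<Rightarrow> bool" where
  "collocation S \<theta> \<longleftrightarrow>
     (\<forall>m<dim_z S. 0 < npts S m \<and> (\<forall>i<npts S m. pts S m i \<in> {z_lo S m<..<z_hi S m})) \<and>
     (\<forall>\<beta><rank_A S. \<forall>m<dim_z S. \<forall>a<width S m.
        (\<exists>h. cont_rep (leb1 S m) (cl1 S m) (op_Am S \<beta> m (feat S m a (\<theta> m))) h) \<and>
        (\<forall>j<npar S m. \<exists>h. cont_rep (leb1 S m) (cl1 S m) (op_Am S \<beta> m (d_feat S \<theta> m a j)) h)) \<and>
     rhs S \<in> car (L2 (leb_D S))"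

section \<open>Jacobian, residual and factors\<close>

definition N_D :: "setting \<Rightarrow> nat" where
  "N_D S = (\<Prod>m<dim_z S. npts S m)"

definition N_par :: "setting \<Rightarrow> nat" where
  "N_par S = (\<Sum>m<dim_z S. npar S m)"

definition N_s :: "setting \<Rightarrow> nat \<Rightarrow> nat" where
  "N_s S s = rank_A S * npts S s * width S s"

definition N_eff :: "setting \<Rightarrow> nat" where
  "N_eff S = (\<Sum>s<dim_z S. N_s S s)"

text \<open>The collocation multi-index, and the collocation point, of row \<open>r\<close>.\<close>

definition row_ix :: "setting \<Rightarrow> nat \<Rightarrow> nat list" where
  "row_ix S r = lex_dec (sizes S (npts S)) r"

definition grid :: "setting \<Rightarrow> nat \<Rightarrow> (nat \<Rightarrow> real)" where
  "grid S r = (\<lambda>m\<in>{..<dim_z S}. pts S m (row_ix S r ! m))"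

definition eval_D :: "setting \<Rightarrow> ((nat \<Rightarrow> real) \<Rightarrow> real) \<Rightarrow> (nat \<Rightarrow> real) \<Rightarrow> real" where
  "eval_D S = cont_eval (leb_D S) (cl_box S (dim_z S))"

definition eval1 :: "setting \<Rightarrow> nat \<Rightarrow> (real \<Rightarrow> real) \<Rightarrow> real \<Rightarrow> real" where
  "eval1 S m = cont_eval (leb1 S m) (cl1 S m)"

definition Jac :: "setting \<Rightarrow> (nat \<Rightarrow> real Matrix.vec) \<Rightarrow> nat \<Rightarrow> real mat" where
  "Jac S \<theta> s = Matrix.mat (N_D S) (npar S s) (\<lambda>(r, j). eval_D S (op_A S (d_net S \<theta> s j)) (grid S r))"

definition J_rho :: "setting \<Rightarrow> (nat \<Rightarrow> real Matrix.vec) \<Rightarrow> real mat" where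
  "J_rho S \<theta> = hcat (N_D S) (map (Jac S \<theta>) [0..<dim_z S])"

definition resid :: "setting \<Rightarrow> (nat \<Rightarrow> real Matrix.vec) \<Rightarrow> real Matrix.vec" where
  "resid S \<theta> = Matrix.vec (N_D S) (\<lambda>r. eval_D S (op_A S (net S \<theta>)) (grid S r) - rhs S (grid S r))"

text \<open>
  The discrete gradient of the loss \<open>(vnorm (resid S \<theta>))\<^sup>2 / (2 * N_D S)\<close> is by definition formed from the
  Jacobian, whose entries evaluate the images of parameter derivatives taken in \<open>sp_H S\<close>.
\<close>

definition grad_loss :: "setting \<Rightarrow> (nat \<Rightarrow> real Matrix.vec) \<Rightarrow> real Matrix.vec" where
  "grad_loss S \<theta> = (1 / real (N_D S)) \<cdot>\<^sub>v (transpose_mat (J_rho S \<theta>) *\<^sub>v resid S \<theta>)"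

definition grad_loss_block :: "setting \<Rightarrow> (nat \<Rightarrow> real Matrix.vec) \<Rightarrow> nat \<Rightarrow> real Matrix.vec" where
  "grad_loss_block S \<theta> s = (1 / real (N_D S)) \<cdot>\<^sub>v (transpose_mat (Jac S \<theta> s) *\<^sub>v resid S \<theta>)"

text \<open>
  In \<open>E_fac\<close> the row index is the position of a multi-index with the \<open>s\<close>-th entry
  omitted, whose entry for direction \<open>m\<close> therefore sits at place \<open>m\<close> or \<open>m - 1\<close>.
\<close>

definition E_fac :: "setting \<Rightarrow> (nat \<Rightarrow> real Matrix.vec) \<Rightarrow> nat \<Rightarrow> nat \<Rightarrow> real mat" where
  "E_fac S \<theta> s \<beta> = Matrix.mat (\<Prod>m\<in>{..<dim_z S} - {s}. npts S m) (width S s)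
     (\<lambda>(r, as). let i = lex_dec (omit s (sizes S (npts S))) r in
        \<Sum>a\<in>{a \<in> multi (sizes S (width S)). a ! s = as}.
          core S a * (\<Prod>m\<in>{..<dim_z S} - {s}.
            eval1 S m (op_Am S \<beta> m (feat S m (a ! m) (\<theta> m)))
              (pts S m (i ! (if m < s then m else m - 1)))))"

definition C_fac :: "setting \<Rightarrow> (nat \<Rightarrow> real Matrix.vec) \<Rightarrow> nat \<Rightarrow> nat \<Rightarrow> real mat" where
  "C_fac S \<theta> s \<beta> = Matrix.mat (npts S s * width S s) (npar S s)
     (\<lambda>(q, j). let ia = lex_dec [npts S s, width S s] q in
        eval1 S s (op_Am S \<beta> s (d_feat S \<theta> s (ia ! 1) j)) (pts S s (ia ! 0)))"

definition Psi_fac :: "setting \<Rightarrow> (nat \<Rightarrow> real Matrix.vec) \<Rightarrow> nat \<Rightarrow> nat \<Rightarrow> real mat" where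
  "Psi_fac S \<theta> s \<beta> = Matrix.mat (N_D S) (npts S s * width S s)
     (\<lambda>(r, q). let i = row_ix S r; ja = lex_dec [npts S s, width S s] q in
        if i ! s = ja ! 0
        then E_fac S \<theta> s \<beta> $$ (lex_pos (omit s (sizes S (npts S))) (omit s i), ja ! 1)
        else 0)"

definition Psi_blk :: "setting \<Rightarrow> (nat \<Rightarrow> real Matrix.vec) \<Rightarrow> nat \<Rightarrow> real mat" where
  "Psi_blk S \<theta> s = hcat (N_D S) (map (Psi_fac S \<theta> s) [0..<rank_A S])"

definition C_blk :: "setting \<Rightarrow> (nat \<Rightarrow> real Matrix.vec) \<Rightarrow> nat \<Rightarrow> real mat" where
  "C_blk S \<theta> s = vcat (npar S s) (map (C_fac S \<theta> s) [0..<rank_A S])"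

definition Psi :: "setting \<Rightarrow> (nat \<Rightarrow> real Matrix.vec) \<Rightarrow> real mat" where
  "Psi S \<theta> = hcat (N_D S) (map (Psi_blk S \<theta>) [0..<dim_z S])"

definition C_diag :: "setting \<Rightarrow> (nat \<Rightarrow> real Matrix.vec) \<Rightarrow> real mat" where
  "C_diag S \<theta> = diag_block_mat (map (C_blk S \<theta>) [0..<dim_z S])"

definition scaled_gram :: "setting \<Rightarrow> real mat \<Rightarrow> real mat \<Rightarrow> real mat" where
  "scaled_gram S A B = (1 / real (N_D S)) \<cdot>\<^sub>m (transpose_mat A * B)"

definition Upsilon :: "setting \<Rightarrow> (nat \<Rightarrow> real Matrix.vec) \<Rightarrow> real mat" where
  "Upsilon S \<theta> = scaled_gram S (Psi S \<theta>) (Psi S \<theta>)"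

definition Upsilon_blk :: "setting \<Rightarrow> (nat \<Rightarrow> real Matrix.vec) \<Rightarrow> nat \<Rightarrow> nat \<Rightarrow> real mat" where
  "Upsilon_blk S \<theta> s t = scaled_gram S (Psi_blk S \<theta> s) (Psi_blk S \<theta> t)"

definition Upsilon_fac :: "setting \<Rightarrow> (nat \<Rightarrow> real Matrix.vec) \<Rightarrow> nat \<Rightarrow> nat \<Rightarrow> nat \<Rightarrow> nat \<Rightarrow> real mat" where
  "Upsilon_fac S \<theta> s t \<beta> \<gamma> = scaled_gram S (Psi_fac S \<theta> s \<beta>) (Psi_fac S \<theta> t \<gamma>)"

definition Gram :: "setting \<Rightarrow> (nat \<Rightarrow> real Matrix.vec) \<Rightarrow> real mat" where
  "Gram S \<theta> = scaled_gram S (J_rho S \<theta>) (J_rho S \<theta>)"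

definition Gram_blk :: "setting \<Rightarrow> (nat \<Rightarrow> real Matrix.vec) \<Rightarrow> nat \<Rightarrow> nat \<Rightarrow> real mat" where
  "Gram_blk S \<theta> s t = scaled_gram S (Jac S \<theta> s) (Jac S \<theta> t)"

definition rho_c :: "setting \<Rightarrow> (nat \<Rightarrow> real Matrix.vec) \<Rightarrow> real Matrix.vec" where
  "rho_c S \<theta> = (1 / real (N_D S)) \<cdot>\<^sub>v (transpose_mat (Psi S \<theta>) *\<^sub>v resid S \<theta>)"

definition rho_c_blk :: "setting \<Rightarrow> (nat \<Rightarrow> real Matrix.vec) \<Rightarrow> nat \<Rightarrow> real Matrix.vec" where
  "rho_c_blk S \<theta> s = (1 / real (N_D S)) \<cdot>\<^sub>v (transpose_mat (Psi_blk S \<theta> s) *\<^sub>v resid S \<theta>)"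

definition rho_c_fac :: "setting \<Rightarrow> (nat \<Rightarrow> real Matrix.vec) \<Rightarrow> nat \<Rightarrow> nat \<Rightarrow> real Matrix.vec" where
  "rho_c_fac S \<theta> s \<beta> = (1 / real (N_D S)) \<cdot>\<^sub>v (transpose_mat (Psi_fac S \<theta> s \<beta>) *\<^sub>v resid S \<theta>)"

end

theory Submission
  imports Defs
begin

text \<open>
  Only the identity \<open>Jac S \<theta> s = Psi_blk S \<theta> s * C_blk S \<theta> s\<close> uses analysis. A tensor of
  univariate functions is linear in its \<open>s\<close>-th factor and the norm of \<open>sp_H S\<close> is a cross norm, so the
  partial derivatives of the network are obtained by differentiating one factor; applying the separable
  operator and evaluating at a grid point then gives, for each \<open>\<beta>\<close>, a sum over multi-indices which,
  grouped by the \<open>s\<close>-th index, is a row of \<open>Psi_fac\<close> times a column of \<open>C_fac\<close>. Evaluation commutes with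
  the tensor product because functions that are continuous on the closed box and equal almost everywhere
  agree at interior points. The rest is block-matrix algebra, except for the rank of the Gramian: the kernel
  of \<open>A\<^sup>T A\<close> is that of \<open>A\<close>, so \<open>A\<^sup>T\<close> is injective on the column space of \<open>A\<close>.
\<close>

section \<open>Block matrices\<close>

text \<open>The obstacle is the gap between classes and point values. Partial derivatives and
  continuous representatives are picked by \<open>SOME\<close>, and operators are linear only up to
  \<open>eqv\<close>. So \<open>d_net\<close> is known only modulo functions of norm zero in
  \<open>sp_H S\<close>, and its image under \<open>op_A\<close> only almost everywhere, whereas a
  Jacobian entry is a value at a single point. Three facts close the gap. A bounded operator into L2
  sends functions of norm zero to functions that vanish almost everywhere. The explicit sum of
  products of univariate representatives is one continuous representative of the image. Two such
  representatives cannot differ at a grid point, since grid points are interior. Linearity is taken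
  from the tensor operators on \<open>sp_H S\<close>, because these are the operators whose action
  on an elementary tensor is known factor by factor.\<close>

lemma hcat_carrier: "hcat nr As \<in> carrier_mat nr (sum_list (map dim_col As))"
  unfolding hcat_def by (rule carrier_matI) (auto simp: length_concat comp_def)

lemma vcat_carrier: "vcat nc As \<in> carrier_mat (sum_list (map dim_row As)) nc"
  unfolding vcat_def by (rule carrier_matI) (auto simp: length_concat comp_def)

lemma transpose_hcat: "transpose_mat (hcat nr As) = vcat nr (map transpose_mat As)"
  unfolding hcat_def vcat_def by (simp add: transpose_mat_of_cols comp_def)

lemma transpose_vcat: "transpose_mat (vcat nc As) = hcat nc (map transpose_mat As)"
  unfolding hcat_def vcat_def by (simp add: transpose_mat_of_rows comp_def)

lemma cols_smult_mult:
  "cols (c \<cdot>\<^sub>m (A * B)) = map (\<lambda>v. c \<cdot>\<^sub>v (A *\<^sub>v v)) (cols B)"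
  by (rule nth_equalityI) (auto simp: cols_def)

text \<open>A product acts on each column of the right factor separately. The scalar is carried
  along because the Gramians come with the factor \<open>1 / real (N_D S)\<close>.\<close>

lemma smult_mult_hcat:
  assumes "A \<in> carrier_mat n nr" "\<And>B. B \<in> set Bs \<Longrightarrow> dim_row B = nr"
  shows "c \<cdot>\<^sub>m (A * hcat nr Bs) = hcat n (map (\<lambda>B. c \<cdot>\<^sub>m (A * B)) Bs)"
proof -
  have C: "set (concat (map cols Bs)) \<subseteq> carrier_vec nr"
    using assms(2) by (auto simp: cols_def col_def)
  have "cols (c \<cdot>\<^sub>m (A * hcat nr Bs)) = concat (map cols (map (\<lambda>B. c \<cdot>\<^sub>m (A * B)) Bs))"
    unfolding cols_smult_mult hcat_def using C
    by (simp add: cols_smult_mult map_concat comp_def)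
  then show ?thesis
    unfolding hcat_def[of n] using assms(1) by (metis carrier_matD(1) index_mult_mat(2) index_smult_mat(2) mat_of_cols_cols)
qed

lemma vcat_eq_transpose: "vcat nc As = transpose_mat (hcat nc (map transpose_mat As))"
  by (simp add: transpose_hcat comp_def)

text \<open>The transpose of \<open>smult_mult_hcat\<close>; transposing reverses products, which is
  why the entries have to commute.\<close>

lemma smult_vcat_mult:
  fixes c :: "'a::comm_semiring_0"
  assumes "B \<in> carrier_mat nc n" "\<And>A. A \<in> set As \<Longrightarrow> dim_col A = nc"
  shows "c \<cdot>\<^sub>m (vcat nc As * B) = vcat n (map (\<lambda>A. c \<cdot>\<^sub>m (A * B)) As)"
proof -
  have smt: "transpose_mat (c \<cdot>\<^sub>m M) = c \<cdot>\<^sub>m transpose_mat M" for M :: "'a mat"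
    by (rule eq_matI) auto
  have "transpose_mat (c \<cdot>\<^sub>m (vcat nc As * B)) =
      c \<cdot>\<^sub>m (transpose_mat B * hcat nc (map transpose_mat As))"
    using assms(1) vcat_carrier[of nc As] by (simp add: smt transpose_mult transpose_vcat)
  also have "\<dots> = hcat n (map (\<lambda>A. transpose_mat (c \<cdot>\<^sub>m (A * B))) As)"
  proof (subst smult_mult_hcat)
    show "transpose_mat B \<in> carrier_mat n nc" using assms(1) by simp
    show "dim_row M = nc" if "M \<in> set (map transpose_mat As)" for M using that assms(2) by auto
    have "c \<cdot>\<^sub>m (transpose_mat B * transpose_mat A) = transpose_mat (c \<cdot>\<^sub>m (A * B))" if "A \<in> set As" for A
    proof -
      have "A \<in> carrier_mat (dim_row A) nc" using assms(2)[OF that] by auto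
      from transpose_mult[OF this assms(1)] show ?thesis by (simp only: smt)
    qed
    then have "map (\<lambda>A. c \<cdot>\<^sub>m (transpose_mat B * transpose_mat A)) As =
        map (\<lambda>A. transpose_mat (c \<cdot>\<^sub>m (A * B))) As" by simp
    then show "hcat n (map (\<lambda>A. c \<cdot>\<^sub>m (transpose_mat B * A)) (map transpose_mat As)) =
        hcat n (map (\<lambda>A. transpose_mat (c \<cdot>\<^sub>m (A * B))) As)"
      by (simp only: map_map comp_def)
  qed
  finally have "transpose_mat (transpose_mat (c \<cdot>\<^sub>m (vcat nc As * B)))
     = transpose_mat (hcat n (map (\<lambda>A. transpose_mat (c \<cdot>\<^sub>m (A * B))) As))" by simp
  then show ?thesis by (simp add: transpose_hcat comp_def)
qed

text \<open>Each entry of the product comes from one row, so cutting the rows into blocks cuts the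
  vector. Since \<open>vstack\<close> concatenates lists of entries, the identity is proved for
  \<open>list_of_vec\<close>.\<close>

lemma smult_vcat_mult_vec:
  assumes "\<And>A. A \<in> set As \<Longrightarrow> dim_col A = nc"
  shows "c \<cdot>\<^sub>v (vcat nc As *\<^sub>v x) = vstack (map (\<lambda>A. c \<cdot>\<^sub>v (A *\<^sub>v x)) As)"
proof -
  have rw: "set (concat (map rows As)) \<subseteq> carrier_vec nc"
    using assms by (auto simp: Matrix.rows_def row_def)
  have lv: "list_of_vec (c \<cdot>\<^sub>v (A *\<^sub>v x)) = map (\<lambda>r. c * scalar_prod r x) (rows A)" for A
    by (rule nth_equalityI) (auto simp: list_of_vec_index)
  have "list_of_vec (c \<cdot>\<^sub>v (vcat nc As *\<^sub>v x)) = concat (map list_of_vec (map (\<lambda>A. c \<cdot>\<^sub>v (A *\<^sub>v x)) As))"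
    unfolding lv using rw by (simp add: vcat_def map_concat comp_def lv)
  then show ?thesis unfolding vstack_def by (metis vec_list)
qed

text \<open>A four-block matrix whose lower blocks have no rows: in this form inductions over a list
  of blocks can use \<open>mult_four_block_mat\<close>.\<close>

lemma hcat_Cons:
  assumes "dim_row A = nr"
  shows "hcat nr (A # As) =
    four_block_mat A (hcat nr As) (0\<^sub>m 0 (dim_col A)) (0\<^sub>m 0 (sum_list (map dim_col As)))"
proof (rule eq_matI)
  have H: "dim_row (hcat nr As) = nr" "dim_col (hcat nr As) = sum_list (map dim_col As)"
    "dim_row (hcat nr (A # As)) = nr" "dim_col (hcat nr (A # As)) = dim_col A + sum_list (map dim_col As)"
    using hcat_carrier[of nr As] hcat_carrier[of nr "A # As"] by auto
  then show "dim_row (hcat nr (A # As)) = dim_row (four_block_mat A (hcat nr As) (0\<^sub>m 0 (dim_col A)) (0\<^sub>m 0 (sum_list (map dim_col As))))"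
    "dim_col (hcat nr (A # As)) = dim_col (four_block_mat A (hcat nr As) (0\<^sub>m 0 (dim_col A)) (0\<^sub>m 0 (sum_list (map dim_col As))))"
    using assms by auto
  fix i j assume "i < dim_row (four_block_mat A (hcat nr As) (0\<^sub>m 0 (dim_col A)) (0\<^sub>m 0 (sum_list (map dim_col As))))"
    "j < dim_col (four_block_mat A (hcat nr As) (0\<^sub>m 0 (dim_col A)) (0\<^sub>m 0 (sum_list (map dim_col As))))"
  then have ij: "i < nr" "j < dim_col A + sum_list (map dim_col As)" using H assms by auto
  have len: "length (concat (map cols As)) = sum_list (map dim_col As)"
    by (simp add: length_concat comp_def)
  show "hcat nr (A # As) $$ (i, j) = four_block_mat A (hcat nr As) (0\<^sub>m 0 (dim_col A)) (0\<^sub>m 0 (sum_list (map dim_col As))) $$ (i, j)"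
    using ij H assms len by (auto simp: hcat_def mat_of_cols_index nth_append)
qed

lemma vcat_Cons:
  assumes "dim_col A = nc"
  shows "vcat nc (A # As) =
    four_block_mat A (0\<^sub>m (dim_row A) 0) (vcat nc As) (0\<^sub>m (sum_list (map dim_row As)) 0)"
proof -
  have H: "hcat nc (map transpose_mat As) \<in> carrier_mat nc (sum_list (map dim_row As))"
    using hcat_carrier[of nc "map transpose_mat As"] by (simp add: comp_def)
  have "transpose_mat (hcat nc (map transpose_mat (A # As))) =
    transpose_mat (four_block_mat (transpose_mat A) (hcat nc (map transpose_mat As)) (0\<^sub>m 0 (dim_row A)) (0\<^sub>m 0 (sum_list (map dim_row As))))"
    using hcat_Cons[of "transpose_mat A" nc "map transpose_mat As"] assms by (simp add: comp_def)
  also have "\<dots> = four_block_mat A (0\<^sub>m (dim_row A) 0) (vcat nc As) (0\<^sub>m (sum_list (map dim_row As)) 0)"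
    using assms H by (subst transpose_four_block_mat[where ?nr1.0=nc and ?nc1.0="dim_row A" and ?nr2.0=0 and ?nc2.0="sum_list (map dim_row As)"])
      (auto simp: transpose_hcat comp_def)
  finally show ?thesis by (simp add: vcat_eq_transpose)
qed

text \<open>\<open>diag_block_mat\<close> is itself a recursion over four-block matrices, so both
  factors split at the same place and the zero off-diagonal blocks remove the cross terms.\<close>

lemma hcat_mult_diag_block_mat:
  fixes f g :: "'b \<Rightarrow> 'a::comm_semiring_1 mat"
  assumes "\<And>x. x \<in> set xs \<Longrightarrow> f x \<in> carrier_mat nr (n x)" "\<And>x. x \<in> set xs \<Longrightarrow> g x \<in> carrier_mat (n x) (m x)"
  shows "hcat nr (map f xs) * diag_block_mat (map g xs) = hcat nr (map (\<lambda>x. f x * g x) xs)"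
  using assms
proof (induction xs)
  case Nil
  show ?case using hcat_carrier[of nr "[] :: 'a mat list"] by (auto intro!: eq_matI)
next
  case (Cons x xs)
  let ?H = "hcat nr (map f xs)" and ?D = "diag_block_mat (map g xs)"
  have d: "map dim_col (map f xs) = map n xs" "map dim_row (map g xs) = map n xs"
     "map dim_col (map g xs) = map m xs" "map dim_col (map (\<lambda>x. f x * g x) xs) = map m xs"
    using Cons.prems by auto
  have H: "?H \<in> carrier_mat nr (sum_list (map n xs))" using hcat_carrier[of nr "map f xs"] d by metis
  have D: "?D \<in> carrier_mat (sum_list (map n xs)) (sum_list (map m xs))"
    using dim_diag_block_mat[of "map g xs"] d by (metis carrier_matI)
  have fx: "f x \<in> carrier_mat nr (n x)" and gx: "g x \<in> carrier_mat (n x) (m x)" using Cons.prems by auto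
  have IH: "?H * ?D = hcat nr (map (\<lambda>x. f x * g x) xs)" using Cons by simp
  have h1: "hcat nr (map f (x # xs)) = four_block_mat (f x) ?H (0\<^sub>m 0 (n x)) (0\<^sub>m 0 (sum_list (map n xs)))"
    using hcat_Cons[of "f x" nr "map f xs"] fx d(1) by (simp del: map_map)
  have h2: "diag_block_mat (map g (x # xs)) = four_block_mat (g x) (0\<^sub>m (n x) (sum_list (map m xs)))
      (0\<^sub>m (sum_list (map n xs)) (m x)) ?D"
    using gx D by (simp add: Let_def)
  have h3: "hcat nr (map (\<lambda>x. f x * g x) (x # xs)) =
      four_block_mat (f x * g x) (?H * ?D) (0\<^sub>m 0 (m x)) (0\<^sub>m 0 (sum_list (map m xs)))"
    using hcat_Cons[of "f x * g x" nr "map (\<lambda>x. f x * g x) xs"] fx gx IH unfolding d(4) by simp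
  have z: "f x * g x + ?H * 0\<^sub>m (sum_list (map n xs)) (m x) = f x * g x"
    "f x * 0\<^sub>m (n x) (sum_list (map m xs)) + ?H * ?D = ?H * ?D"
    "0\<^sub>m 0 (n x) * g x + 0\<^sub>m 0 (sum_list (map n xs)) * 0\<^sub>m (sum_list (map n xs)) (m x) = 0\<^sub>m 0 (m x)"
    "0\<^sub>m 0 (n x) * 0\<^sub>m (n x) (sum_list (map m xs)) + 0\<^sub>m 0 (sum_list (map n xs)) * ?D = 0\<^sub>m 0 (sum_list (map m xs))"
    using fx gx H D by auto
  show ?case unfolding h1 h2 h3
    by (subst mult_four_block_mat[OF fx H zero_carrier_mat zero_carrier_mat gx zero_carrier_mat zero_carrier_mat D])
      (simp only: z)
qed

text \<open>Stated entry by entry because matrices of one size do not form a type over which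
  \<open>sum_list\<close> could run.\<close>

lemma hcat_mult_vcat_index:
  fixes f g :: "'b \<Rightarrow> 'a::comm_semiring_1 mat"
  assumes "\<And>x. x \<in> set xs \<Longrightarrow> f x \<in> carrier_mat nr (n x)" "\<And>x. x \<in> set xs \<Longrightarrow> g x \<in> carrier_mat (n x) nc"
    and "i < nr" "j < nc"
  shows "(hcat nr (map f xs) * vcat nc (map g xs)) $$ (i, j) = (\<Sum>x\<leftarrow>xs. (f x * g x) $$ (i, j))"
  using assms(1,2)
proof (induction xs)
  case Nil
  then show ?case using hcat_carrier[of nr "[] :: 'a mat list"] vcat_carrier[of nc "[] :: 'a mat list"] assms(3,4)
    by (simp add: scalar_prod_def)
next
  case (Cons x xs)
  let ?H = "hcat nr (map f xs)" and ?V = "vcat nc (map g xs)"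
  have d: "map dim_col (map f xs) = map n xs" "map dim_row (map g xs) = map n xs"
    using Cons.prems by auto
  have H: "?H \<in> carrier_mat nr (sum_list (map n xs))" using hcat_carrier[of nr "map f xs"] d by metis
  have V: "?V \<in> carrier_mat (sum_list (map n xs)) nc" using vcat_carrier[of nc "map g xs"] d by metis
  have fx: "f x \<in> carrier_mat nr (n x)" and gx: "g x \<in> carrier_mat (n x) nc" using Cons.prems by auto
  have h1: "hcat nr (map f (x # xs)) = four_block_mat (f x) ?H (0\<^sub>m 0 (n x)) (0\<^sub>m 0 (sum_list (map n xs)))"
    using hcat_Cons[of "f x" nr "map f xs"] fx d(1) by (simp del: map_map)
  have h2: "vcat nc (map g (x # xs)) = four_block_mat (g x) (0\<^sub>m (n x) 0) ?V (0\<^sub>m (sum_list (map n xs)) 0)"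
    using vcat_Cons[of "g x" nc "map g xs"] gx d(2) by (simp del: map_map)
  have "(hcat nr (map f (x # xs)) * vcat nc (map g (x # xs))) $$ (i, j) = (f x * g x + ?H * ?V) $$ (i, j)"
    unfolding h1 h2
    by (subst mult_four_block_mat[OF fx H zero_carrier_mat zero_carrier_mat gx zero_carrier_mat V zero_carrier_mat])
      (use fx gx H V assms(3,4) in \<open>auto simp del: index_mult_mat(1)\<close>)
  also have "\<dots> = (f x * g x) $$ (i, j) + (?H * ?V) $$ (i, j)"
    using fx gx H V assms(3,4) by (intro index_add_mat(1)) auto
  also have "(?H * ?V) $$ (i, j) = (\<Sum>x\<leftarrow>xs. (f x * g x) $$ (i, j))" using Cons by simp
  finally show ?case by simp
qed

text \<open>With transposes as left blocks, this one identity yields the block forms of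
  \<open>Upsilon\<close>, of each \<open>Upsilon_blk\<close> and of \<open>Gram\<close>.\<close>

lemma block_matrix_mult:
  fixes f g :: "nat \<Rightarrow> 'a::comm_semiring_1 mat"
  assumes "\<And>s. s < p \<Longrightarrow> f s \<in> carrier_mat (ht s) nr" "\<And>t. t < q \<Longrightarrow> g t \<in> carrier_mat nr (wd t)"
  shows "c \<cdot>\<^sub>m (vcat nr (map f [0..<p]) * hcat nr (map g [0..<q])) =
    block_matrix p q ht wd (\<lambda>s t. c \<cdot>\<^sub>m (f s * g t))"
proof -
  have "map dim_col (map g [0..<q]) = map wd [0..<q]" using assms(2) by fastforce
  then have G: "hcat nr (map g [0..<q]) \<in> carrier_mat nr (\<Sum>t<q. wd t)"
    using hcat_carrier[of nr "map g [0..<q]"]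
    by (simp add: interv_sum_list_conv_sum_set_nat atLeast0LessThan)
  have "c \<cdot>\<^sub>m (f s * hcat nr (map g [0..<q])) = hcat (ht s) (map (\<lambda>t. c \<cdot>\<^sub>m (f s * g t)) [0..<q])" if "s < p" for s
    using assms(1)[OF that] assms(2) by (subst smult_mult_hcat[where n="ht s"]) (fastforce simp: comp_def)+
  then show ?thesis
    unfolding block_matrix_def using assms(1)
    by (subst smult_vcat_mult[OF G]) (fastforce simp: comp_def intro!: arg_cong[where f="vcat _"])+
qed



lemma hcat_map_carrier:
  assumes "\<And>t. t < q \<Longrightarrow> B t \<in> carrier_mat nr (wd t)"
  shows "hcat nr (map B [0..<q]) \<in> carrier_mat nr (\<Sum>t<q. wd t)"
proof -
  have "map dim_col (map B [0..<q]) = map wd [0..<q]" using assms by fastforce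
  then show ?thesis
    using hcat_carrier[of nr "map B [0..<q]"]
    by (simp add: interv_sum_list_conv_sum_set_nat atLeast0LessThan)
qed

lemma vcat_map_carrier:
  assumes "\<And>t. t < q \<Longrightarrow> B t \<in> carrier_mat (ht t) nc"
  shows "vcat nc (map B [0..<q]) \<in> carrier_mat (\<Sum>t<q. ht t) nc"
proof -
  have "map dim_row (map B [0..<q]) = map ht [0..<q]" using assms by fastforce
  then show ?thesis
    using vcat_carrier[of nc "map B [0..<q]"]
    by (simp add: interv_sum_list_conv_sum_set_nat atLeast0LessThan)
qed

section \<open>Rank\<close>

lemma (in vec_space) col_space_image:
  assumes A: "A \<in> carrier_mat n m"
  shows "col_space A = (\<lambda>x. A *\<^sub>v x) ` carrier_vec m"
  using col_space_eq[OF A] A by auto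

text \<open>Rank-nullity for multiplication by \<open>B\<close> restricted to the column space of
  \<open>A\<close>: the image is the column space of \<open>B * A\<close>, and \<open>inj\<close>
  says that the kernel is trivial.\<close>

lemma rank_mult_eq:
  fixes A B :: "'a::field mat"
  assumes A: "A \<in> carrier_mat n m" and B: "B \<in> carrier_mat k n"
    and inj: "\<And>x. x \<in> carrier_vec m \<Longrightarrow> B *\<^sub>v (A *\<^sub>v x) = 0\<^sub>v k \<Longrightarrow> A *\<^sub>v x = 0\<^sub>v n"
  shows "vec_space.rank k (B * A) = vec_space.rank n A"
proof -
  interpret V: vec_space "TYPE('a)" n .
  interpret W: vec_space "TYPE('a)" k .
  let ?U = "V.vs (V.col_space A)"
  note U = V.col_space_image[OF A]
  have cA: "set (cols A) \<subseteq> carrier_vec n" using A by (auto simp: cols_def)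
  have sub: "subspace class_ring (V.col_space A) V.V"
    unfolding V.col_space_def using V.span_is_subspace cA by simp
  have vsU: "vectorspace class_ring ?U" using V.subspace_is_vs[OF sub] .
  have UV: "V.col_space A \<subseteq> carrier_vec n" using U A by auto
  interpret T: linear_map class_ring ?U W.V "\<lambda>v. B *\<^sub>v v"
  proof -
    have "(\<lambda>v. B *\<^sub>v v) \<in> LinearCombinations.module_hom class_ring ?U W.V"
      unfolding LinearCombinations.module_hom_def using B
      by (auto simp: mult_add_distrib_mat_vec[OF B] mult_mat_vec[OF B] module_vec_simps UV[THEN subsetD])
    then show "linear_map class_ring ?U W.V (\<lambda>v. B *\<^sub>v v)"
      using vsU W.vectorspace_axioms unfolding linear_map_def mod_hom_def mod_hom_axioms_def vectorspace_def by auto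
  qed
  have fd: "vectorspace.fin_dim class_ring ?U"
    using V.fin_dim_span_cols[OF A] unfolding V.col_space_def .
  have im: "T.imT = W.col_space (B * A)"
  proof -
    have "W.col_space (B * A) = (\<lambda>x. (B * A) *\<^sub>v x) ` carrier_vec m"
      using A B by (intro W.col_space_image) simp
    also have "\<dots> = (\<lambda>x. B *\<^sub>v (A *\<^sub>v x)) ` carrier_vec m"
      by (intro image_cong refl assoc_mult_mat_vec[OF B A])
    finally show ?thesis
      unfolding T.im_def unfolding U by (simp add: image_image)
  qed
  have ker: "T.kerT = {0\<^sub>v n}"
  proof -
    have "A *\<^sub>v 0\<^sub>v m = 0\<^sub>v n" "B *\<^sub>v 0\<^sub>v n = 0\<^sub>v k"
      using A B by (intro eq_vecI; simp)+
    then have "0\<^sub>v n \<in> V.col_space A" unfolding U by (intro image_eqI[of _ _ "0\<^sub>v m"]) simp_all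
    moreover have "v = 0\<^sub>v n" if "v \<in> V.col_space A" "B *\<^sub>v v = 0\<^sub>v k" for v
      using that inj unfolding U by blast
    moreover have "T.kerT = {v \<in> V.col_space A. B *\<^sub>v v = 0\<^sub>v k}"
    proof -
      have "carrier ?U = V.col_space A" by simp
      then show ?thesis unfolding T.ker_def module_vec_simps by (simp only:)
    qed
    ultimately show ?thesis using \<open>B *\<^sub>v 0\<^sub>v n = 0\<^sub>v k\<close> by blast
  qed
  have "vectorspace.dim class_ring (V.vs {0\<^sub>v n}) = 0"
    using V.dim_zero_vs V.span_empty by (simp add: module_vec_simps)
  then have "vectorspace.dim class_ring (W.vs (W.col_space (B * A))) = vectorspace.dim class_ring ?U"
    using T.rank_nullity[OF fd] im ker by simp
  then show ?thesis
    unfolding V.rank_def W.rank_def V.col_space_def W.col_space_def .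
qed

text \<open>Every vector \<open>A * B * x\<close> is \<open>A\<close> applied to something, so the
  column spaces are nested.\<close>

lemma mrank_mult_le:
  assumes A: "A \<in> carrier_mat n m" and B: "B \<in> carrier_mat m k"
  shows "mrank (A * B) \<le> mrank A"
proof -
  interpret V: vec_space "TYPE(real)" n .
  have AB: "A * B \<in> carrier_mat n k" using A B by simp
  have c: "set (cols A) \<subseteq> carrier_vec n" "set (cols (A * B)) \<subseteq> carrier_vec n"
    using cols_dim[of A] cols_dim[of "A * B"] A by simp_all
  have sA: "subspace class_ring (V.col_space A) V.V" and sB: "subspace class_ring (V.col_space (A * B)) V.V"
    unfolding V.col_space_def using V.span_is_subspace c by auto
  have "V.col_space (A * B) \<subseteq> V.col_space A"
  proof -
    have "(A * B) *\<^sub>v x \<in> (\<lambda>x. A *\<^sub>v x) ` carrier_vec m" if "x \<in> carrier_vec k" for x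
      unfolding assoc_mult_mat_vec[OF A B that] using B that by (intro imageI) simp
    then show ?thesis unfolding V.col_space_image[OF A] V.col_space_image[OF AB] by auto
  qed
  from V.nested_subspaces[OF sA sB this]
  have "V.rank (A * B) \<le> V.rank A"
    using vectorspace.subspace_dim[OF V.subspace_is_vs[OF sA], of "V.col_space (A * B)"]
      V.fin_dim_span_cols[OF A] V.fin_dim_span_cols[OF AB]
    unfolding V.rank_def V.col_space_def by simp
  then show ?thesis unfolding mrank_def using A by simp
qed

lemma mrank_le_dim_row: "mrank A \<le> dim_row A"
proof -
  interpret V: vec_space "TYPE(real)" "dim_row A" .
  have A: "A \<in> carrier_mat (dim_row A) (dim_col A)" by simp
  have "subspace class_ring (V.span (set (cols A))) V.V"
    using V.span_is_subspace cols_dim by simp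
  from V.subspace_dim[OF this V.fin_dim V.fin_dim_span_cols[OF A]] show ?thesis
    unfolding mrank_def V.rank_def V.dim_is_n .
qed

lemma mrank_gram:
  assumes A: "A \<in> carrier_mat n m" and "c \<noteq> 0"
  shows "mrank (c \<cdot>\<^sub>m (transpose_mat A * A)) = mrank A"
proof -
  \<comment> \<open>The scalar goes into the left factor, so that \<open>rank_mult_eq\<close>
    applies to a plain product.\<close>
  let ?B = "c \<cdot>\<^sub>m transpose_mat A"
  have B: "?B \<in> carrier_mat m n" using A by simp
  have "A *\<^sub>v x = 0\<^sub>v n" if x: "x \<in> carrier_vec m" and z: "?B *\<^sub>v (A *\<^sub>v x) = 0\<^sub>v m" for x
  proof -
    have Ax: "A *\<^sub>v x \<in> carrier_vec n" using A x by simp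
    have tA: "transpose_mat A \<in> carrier_mat m n" using A by simp
    have "transpose_mat A *\<^sub>v (A *\<^sub>v x) = 0\<^sub>v m"
    proof (rule eq_vecI)
      fix i assume "i < dim_vec (0\<^sub>v m :: real Matrix.vec)"
      then have i: "i < m" by simp
      then have "vec_index (?B *\<^sub>v (A *\<^sub>v x)) i = c * vec_index (transpose_mat A *\<^sub>v (A *\<^sub>v x)) i"
        using A Ax by (simp add: scalar_prod_def sum_distrib_left mult.assoc)
      then show "vec_index (transpose_mat A *\<^sub>v (A *\<^sub>v x)) i = vec_index (0\<^sub>v m) i"
        using z i \<open>c \<noteq> 0\<close> by simp
    qed (use A in simp)
    \<comment> \<open>The inner product of \<open>A x\<close> with itself equals that of
      \<open>A^T (A x)\<close> with \<open>x\<close>.\<close>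
    then have "scalar_prod (A *\<^sub>v x) (A *\<^sub>v x) = 0"
      using transpose_vec_mult_scalar[OF A x Ax] x by simp
    \<comment> \<open>Definiteness of the scalar product is phrased with \<open>conjugate\<close>,
      which is the identity on real vectors.\<close>
    then have "conjugate (A *\<^sub>v x) = A *\<^sub>v x \<Longrightarrow> A *\<^sub>v x = 0\<^sub>v n"
      using conjugate_square_eq_0_vec[OF Ax] by simp
    moreover have "conjugate (A *\<^sub>v x) = A *\<^sub>v x" by (intro eq_vecI) auto
    ultimately show ?thesis by simp
  qed
  from rank_mult_eq[OF A B this] show ?thesis
    unfolding mrank_def using A mult_smult_assoc_mat[of "transpose_mat A" m n A m c] by simp
qed

lemma mrank_le_dim_col:
   "mrank A \<le> dim_col A"
  unfolding mrank_def by (rule vec_space.rank_le_nc) auto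

section \<open>Partial derivatives in Hilbert spaces of functions\<close>

context
  fixes M :: "'a measure" and X :: "'a fspace"
  assumes X: "hilbert_fspace M X"
begin

lemma hilbert_fspace_closed:
  shows "(\<lambda>x. 0) \<in> car X"
    and "f \<in> car X \<Longrightarrow> g \<in> car X \<Longrightarrow> (\<lambda>x. f x + g x) \<in> car X"
    and "f \<in> car X \<Longrightarrow> (\<lambda>x. r * f x) \<in> car X"
  using X by (auto simp: hilbert_fspace_def)

lemma hilbert_fspace_diff:
  assumes "f \<in> car X" "g \<in> car X"
  shows "(\<lambda>x. f x - g x) \<in> car X"
  using hilbert_fspace_closed(2)[OF assms(1) hilbert_fspace_closed(3)[OF assms(2), of "-1"]] by simp

lemma hilbert_fspace_sum:
  assumes "\<And>a. a \<in> A \<Longrightarrow> f a \<in> car X"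
  shows "(\<lambda>x. \<Sum>a\<in>A. c a * f a x) \<in> car X"
  using assms
  by (induction A rule: infinite_finite_induct) (auto intro!: hilbert_fspace_closed)

lemma nrm_nonneg: "f \<in> car X \<Longrightarrow> 0 \<le> nrm X f"
  using X by (auto simp: hilbert_fspace_def nrm_def)

lemma nrm_scale:
  assumes "f \<in> car X"
  shows "nrm X (\<lambda>x. r * f x) = \<bar>r\<bar> * nrm X f"
proof -
  have "ip X (\<lambda>x. r * f x) (\<lambda>x. r * f x) = r * ip X f (\<lambda>x. r * f x)"
    using X assms unfolding hilbert_fspace_def by blast
  also have "ip X f (\<lambda>x. r * f x) = ip X (\<lambda>x. r * f x) f"
    using X assms unfolding hilbert_fspace_def by blast
  also have "\<dots> = r * ip X f f"
    using X assms unfolding hilbert_fspace_def by blast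
  finally have "ip X (\<lambda>x. r * f x) (\<lambda>x. r * f x) = r\<^sup>2 * ip X f f"
    by (simp add: power2_eq_square)
  then show ?thesis by (simp add: nrm_def real_sqrt_mult)
qed

lemma nrm_zero: "nrm X (\<lambda>x. 0) = 0"
  using nrm_scale[OF hilbert_fspace_closed(1), of 0] by simp

text \<open>A quasi-triangle inequality is all that the limits below need; it follows from the
  parallelogram law, without Cauchy-Schwarz.\<close>

lemma nrm_add_le:
  assumes f: "f \<in> car X" and g: "g \<in> car X"
  shows "nrm X (\<lambda>x. f x + g x) \<le> 2 * (nrm X f + nrm X g)"
proof -
  define g' where "g' = (\<lambda>x. (-1) * g x)"
  have g': "g' \<in> car X" unfolding g'_def using hilbert_fspace_closed(3)[OF g] .
  have add: "ip X (\<lambda>x. a x + b x) h = ip X a h + ip X b h" and sym: "ip X a h = ip X h a"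
    if "a \<in> car X" "b \<in> car X" "h \<in> car X" for a b h
    using X that unfolding hilbert_fspace_def by blast+
  have exp: "ip X (\<lambda>x. a x + b x) (\<lambda>x. a x + b x) = ip X a a + 2 * ip X a b + ip X b b"
    if "a \<in> car X" "b \<in> car X" for a b
    using add[OF that hilbert_fspace_closed(2)[OF that]] add[OF that that(1)] add[OF that that(2)]
      sym[OF that(1) that(1) hilbert_fspace_closed(2)[OF that]]
      sym[OF that(2) that(2) hilbert_fspace_closed(2)[OF that]] sym[OF that(1) that(2) that(2)] by simp
  have "ip X g' f = - ip X g f" unfolding g'_def
    using X f g unfolding hilbert_fspace_def by (metis mult_minus1)
  then have fg': "ip X f g' = - ip X f g" using sym[OF f f g'] sym[OF f f g] by simp
  have "nrm X g' = nrm X g" unfolding g'_def using nrm_scale[OF g, of "-1"] by simp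
  then have gg': "ip X g' g' = ip X g g" by (simp add: nrm_def)
  have nn: "0 \<le> ip X a a" if "a \<in> car X" for a
    using X that unfolding hilbert_fspace_def by blast
  \<comment> \<open>Nonnegativity for \<open>f - g\<close> bounds the cross term
    \<open>2 * ip X f g\<close> by \<open>ip X f f + ip X g g\<close>.\<close>
  have "0 \<le> ip X (\<lambda>x. f x + g' x) (\<lambda>x. f x + g' x)"
    using nn[OF hilbert_fspace_closed(2)[OF f g']] .
  then have "ip X (\<lambda>x. f x + g x) (\<lambda>x. f x + g x) \<le> 2 * ip X f f + 2 * ip X g g"
    unfolding exp[OF f g'] exp[OF f g] fg' gg' by simp
  also have "\<dots> = 2 * (nrm X f)\<^sup>2 + 2 * (nrm X g)\<^sup>2"
    using nn[OF f] nn[OF g] by (simp add: nrm_def)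
  also have "\<dots> \<le> (2 * (nrm X f + nrm X g))\<^sup>2"
    using nrm_nonneg[OF f] nrm_nonneg[OF g] by (simp add: power2_eq_square algebra_simps)
  finally show ?thesis
    using nrm_nonneg[OF f] nrm_nonneg[OF g] by (simp add: nrm_def real_le_lsqrt)
qed

lemma nrm_diff_le:
  assumes f: "f \<in> car X" and g: "g \<in> car X"
  shows "nrm X (\<lambda>x. f x - g x) \<le> 2 * (nrm X f + nrm X g)"
  using nrm_add_le[OF f hilbert_fspace_closed(3)[OF g, of "-1"]] nrm_scale[OF g, of "-1"] by simp

text \<open>Each summand costs another factor 2 from the quasi-triangle inequality, which is
  harmless for a limit equal to 0.\<close>

lemma nrm_sum_tendsto_0:
  assumes "\<And>a t. a \<in> A \<Longrightarrow> f a t \<in> car X" "\<And>a. a \<in> A \<Longrightarrow> ((\<lambda>t. nrm X (f a t)) \<longlongrightarrow> 0) F"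
  shows "((\<lambda>t. nrm X (\<lambda>x. \<Sum>a\<in>A. c a * f a t x)) \<longlongrightarrow> 0) F"
  using assms
proof (induction A rule: infinite_finite_induct)
  case (insert a A)
  have IH: "((\<lambda>t. nrm X (\<lambda>x. \<Sum>a\<in>A. c a * f a t x)) \<longlongrightarrow> 0) F" using insert by simp
  have mem: "(\<lambda>x. \<Sum>a\<in>A. c a * f a t x) \<in> car X" "f a t \<in> car X" for t
    using insert.prems(1) by (auto intro!: hilbert_fspace_sum)
  have "((\<lambda>t. 2 * (\<bar>c a\<bar> * nrm X (f a t) + nrm X (\<lambda>x. \<Sum>a\<in>A. c a * f a t x))) \<longlongrightarrow> 2 * (\<bar>c a\<bar> * 0 + 0)) F"
    using IH insert.prems(2)[of a] by (intro tendsto_intros) auto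
  then have lim: "((\<lambda>t. 2 * (\<bar>c a\<bar> * nrm X (f a t) + nrm X (\<lambda>x. \<Sum>a\<in>A. c a * f a t x))) \<longlongrightarrow> 0) F" by simp
  have le: "nrm X (\<lambda>x. \<Sum>a\<in>insert a A. c a * f a t x)
      \<le> 2 * (\<bar>c a\<bar> * nrm X (f a t) + nrm X (\<lambda>x. \<Sum>a\<in>A. c a * f a t x))" for t
    using nrm_add_le[OF hilbert_fspace_closed(3)[OF mem(2)] mem(1), of "c a" t t] nrm_scale[OF mem(2), of "c a" t] insert.hyps by simp
  have ge: "0 \<le> nrm X (\<lambda>x. \<Sum>a\<in>insert a A. c a * f a t x)" for t
    using insert.prems(1) by (intro nrm_nonneg hilbert_fspace_sum) auto
  show ?case
    by (rule tendsto_sandwich[OF always_eventually always_eventually tendsto_const lim]) (use le ge in auto)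
qed (auto simp: nrm_zero)

text \<open>Both candidates are limits of the same difference quotients, so the norm of their
  difference, a constant in \<open>t\<close>, is below a quantity tending to 0. Norm zero is the
  strongest conclusion possible for representatives.\<close>

lemma has_partial_unique:
  assumes g: "has_partial X p F \<theta> j g" and g': "has_partial X p F \<theta> j g'"
    and F: "\<And>\<eta>. \<eta> \<in> carrier_vec p \<Longrightarrow> F \<eta> \<in> car X" and \<theta>: "\<theta> \<in> carrier_vec p"
  shows "nrm X (\<lambda>x. g x - g' x) = 0"
proof -
  let ?Q = "\<lambda>t x. (F (\<theta> + t \<cdot>\<^sub>v unit_vec p j) x - F \<theta> x) / t"
  have mem: "g \<in> car X" "g' \<in> car X" using g g' by (auto simp: has_partial_def)
  have Q: "?Q t \<in> car X" for t
  proof -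
    have "(\<lambda>x. F (\<theta> + t \<cdot>\<^sub>v unit_vec p j) x - F \<theta> x) \<in> car X"
      using \<theta> by (intro hilbert_fspace_diff F) auto
    from hilbert_fspace_closed(3)[OF this, of "1/t"] show ?thesis by simp
  qed
  have "((\<lambda>t. 2 * (nrm X (\<lambda>x. ?Q t x - g' x) + nrm X (\<lambda>x. ?Q t x - g x))) \<longlongrightarrow> 2 * (0 + 0)) (at 0)"
    using g g' by (intro tendsto_intros) (auto simp: has_partial_def)
  moreover have "nrm X (\<lambda>x. g x - g' x) \<le> 2 * (nrm X (\<lambda>x. ?Q t x - g' x) + nrm X (\<lambda>x. ?Q t x - g x))" for t
    using nrm_diff_le[OF hilbert_fspace_diff[OF Q mem(2)] hilbert_fspace_diff[OF Q mem(1)], of t t] by simp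
  ultimately have "nrm X (\<lambda>x. g x - g' x) \<le> 2 * (0 + 0)"
    by (intro tendsto_lowerbound[where F="at (0::real)"]) auto
  then show ?thesis using nrm_nonneg[OF hilbert_fspace_diff[OF mem]] by simp
qed

text \<open>On the line through \<open>\<theta>\<close> in the direction of the unit vector
  \<open>j\<close>, the increment has norm \<open>\<bar>t\<bar>\<close> and linear part
  \<open>t * G j\<close>. Dividing the Frechet estimate by \<open>\<bar>t\<bar>\<close> leaves the
  difference quotient minus \<open>G j\<close>.\<close>

lemma frechet_differentiable_imp_has_partial:
  assumes d: "frechet_differentiable_at X p F \<theta>"
    and F: "\<And>\<eta>. \<eta> \<in> carrier_vec p \<Longrightarrow> F \<eta> \<in> car X" and \<theta>: "\<theta> \<in> carrier_vec p" and j: "j < p"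
  shows "\<exists>g. has_partial X p F \<theta> j g"
proof -
  from d obtain G where G: "\<And>j. j < p \<Longrightarrow> G j \<in> car X" and
    lim: "\<And>e. e > 0 \<Longrightarrow> \<exists>\<delta>>0. \<forall>\<eta>\<in>carrier_vec p. vnorm (\<eta> - \<theta>) < \<delta> \<longrightarrow>
          nrm X (\<lambda>x. F \<eta> x - F \<theta> x - (\<Sum>j<p. vec_index (\<eta> - \<theta>) j * G j x)) \<le> e * vnorm (\<eta> - \<theta>)"
    unfolding frechet_differentiable_at_def by blast
  let ?u = "\<lambda>t. \<theta> + t \<cdot>\<^sub>v unit_vec p j"
  have u: "?u t \<in> carrier_vec p" for t using \<theta> by simp
  have diff: "?u t - \<theta> = t \<cdot>\<^sub>v unit_vec p j" for t using \<theta> by (intro eq_vecI) auto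
  have vn: "vnorm (?u t - \<theta>) = \<bar>t\<bar>" for t
  proof -
    have "scalar_prod (t \<cdot>\<^sub>v unit_vec p j) (t \<cdot>\<^sub>v unit_vec p j) = t * (t * scalar_prod (unit_vec p j) (unit_vec p j))"
      by (simp add: scalar_prod_smult_left scalar_prod_smult_right del: scalar_prod_left_unit scalar_prod_right_unit)
    then show ?thesis using j unfolding diff vnorm_def by simp
  qed
  have sm: "(\<Sum>i<p. vec_index (?u t - \<theta>) i * G i x) = t * G j x" for t x
  proof -
    have "(\<Sum>i<p. vec_index (?u t - \<theta>) i * G i x) = (\<Sum>i<p. if i = j then t * G j x else 0)"
      unfolding diff by (intro sum.cong refl) (use j in auto)
    then show ?thesis using j by simp
  qed
  have "((\<lambda>t. nrm X (\<lambda>x. (F (?u t) x - F \<theta> x) / t - G j x)) \<longlongrightarrow> 0) (at 0)"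
  proof (rule LIM_I)
    fix r :: real assume r: "r > 0"
    \<comment> \<open>Half of \<open>r\<close>, because the estimate is not strict while the limit
      asks for a strict bound.\<close>
    from lim[of "r/2"] r obtain \<delta> where \<delta>: "\<delta> > 0" and
      est: "\<And>\<eta>. \<eta> \<in> carrier_vec p \<Longrightarrow> vnorm (\<eta> - \<theta>) < \<delta> \<Longrightarrow>
          nrm X (\<lambda>x. F \<eta> x - F \<theta> x - (\<Sum>j<p. vec_index (\<eta> - \<theta>) j * G j x)) \<le> r/2 * vnorm (\<eta> - \<theta>)" by auto
    have "norm (nrm X (\<lambda>x. (F (?u t) x - F \<theta> x) / t - G j x) - 0) < r" if t: "t \<noteq> 0" "norm (t - 0) < \<delta>" for t
    proof -
      have m: "(\<lambda>x. F (?u t) x - F \<theta> x - t * G j x) \<in> car X"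
        by (intro hilbert_fspace_diff hilbert_fspace_closed F u \<theta> G j)
      have "nrm X (\<lambda>x. (F (?u t) x - F \<theta> x) / t - G j x) = nrm X (\<lambda>x. (1/t) * (F (?u t) x - F \<theta> x - t * G j x))"
        using t by (intro arg_cong[where f="nrm X"] ext) (simp add: field_simps)
      also have "\<dots> = \<bar>1/t\<bar> * nrm X (\<lambda>x. F (?u t) x - F \<theta> x - t * G j x)" by (rule nrm_scale[OF m])
      also have "\<dots> \<le> \<bar>1/t\<bar> * (r/2 * \<bar>t\<bar>)"
        using est[OF u, of t] t unfolding vn sm by (intro mult_left_mono) auto
      also have "\<dots> = r/2" using t by simp
      finally have "nrm X (\<lambda>x. (F (?u t) x - F \<theta> x) / t - G j x) < r" using r by simp
      moreover have "0 \<le> nrm X (\<lambda>x. (F (?u t) x - F \<theta> x) / t - G j x)"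
      proof (rule nrm_nonneg)
        show "(\<lambda>x. (F (?u t) x - F \<theta> x) / t - G j x) \<in> car X"
          using hilbert_fspace_diff[OF hilbert_fspace_closed(3)[OF hilbert_fspace_diff[OF F[OF u] F[OF \<theta>]], of "1/t"] G[OF j]] by simp
      qed
      ultimately show ?thesis by simp
    qed
    then show "\<exists>s>0. \<forall>t. t \<noteq> 0 \<and> norm (t - 0) < s \<longrightarrow>
        norm (nrm X (\<lambda>x. (F (?u t) x - F \<theta> x) / t - G j x) - 0) < r" using \<delta> by blast
  qed
  then show ?thesis using G[OF j] unfolding has_partial_def by blast
qed

end

section \<open>Product functions with one varying factor\<close>

lemma tens_upd:
  assumes "s < d"
  shows "tens d (v(s := f)) z = f (z s) * (\<Prod>m\<in>{..<d} - {s}. v m (z m))"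
  unfolding tens_def using assms by (subst prod.remove[of _ s]) (auto intro!: prod.cong)

text \<open>Varying only factor \<open>s\<close> scales its norm by a constant, so convergence in
  \<open>Hm s\<close> passes to \<open>H\<close>.\<close>

lemma nrm_tens_upd:
  assumes H: "hilbert_tensor_product d M Hm H" and v: "\<And>m. m < d \<Longrightarrow> m \<noteq> s \<Longrightarrow> v m \<in> car (Hm m)"
    and f: "f \<in> car (Hm s)" and s: "s < d"
  shows "nrm H (tens d (v(s := f))) = nrm (Hm s) f * sqrt (\<Prod>m\<in>{..<d} - {s}. ip (Hm m) (v m) (v m))"
proof -
  let ?w = "v(s := f)"
  have "\<forall>m<d. ?w m \<in> car (Hm m)" using v f by auto
  then have "ip H (tens d ?w) (tens d ?w) = (\<Prod>m<d. ip (Hm m) (?w m) (?w m))"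
    using H unfolding hilbert_tensor_product_def by blast
  also have "\<dots> = ip (Hm s) f f * (\<Prod>m\<in>{..<d} - {s}. ip (Hm m) (v m) (v m))"
    using s by (subst prod.remove[of _ s]) (auto intro!: prod.cong)
  finally show ?thesis by (simp add: nrm_def real_sqrt_mult)
qed

text \<open>Since the tensors are linear in factor \<open>s\<close>, the error of the difference
  quotient of the whole sum is a sum of tensors whose factor \<open>s\<close> is the univariate
  error \<open>?r\<close>.\<close>

lemma has_partial_sum_tens:
  assumes H: "hilbert_tensor_product d M Hm H" and Hs: "hilbert_fspace N (Hm s)"
    and v: "\<And>a m. a \<in> A \<Longrightarrow> m < d \<Longrightarrow> m \<noteq> s \<Longrightarrow> v a m \<in> car (Hm m)"
    and F: "\<And>a \<eta>. a \<in> A \<Longrightarrow> \<eta> \<in> carrier_vec p \<Longrightarrow> F a \<eta> \<in> car (Hm s)"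
    and g: "\<And>a. a \<in> A \<Longrightarrow> has_partial (Hm s) p (F a) \<theta> j (g a)"
    and s: "s < d" and \<theta>: "\<theta> \<in> carrier_vec p"
  shows "has_partial H p (\<lambda>\<eta> z. \<Sum>a\<in>A. c a * tens d ((v a)(s := F a \<eta>)) z) \<theta> j
    (\<lambda>z. \<Sum>a\<in>A. c a * tens d ((v a)(s := g a)) z)"
proof -
  have hH: "hilbert_fspace M H" using H by (simp add: hilbert_tensor_product_def)
  have tens_mem: "tens d ((v a)(s := f)) \<in> car H" if "a \<in> A" "f \<in> car (Hm s)" for a f
    using H v that unfolding hilbert_tensor_product_def by auto
  have gm: "g a \<in> car (Hm s)" if "a \<in> A" for a using g[OF that] by (simp add: has_partial_def)
  let ?u = "\<lambda>t. \<theta> + t \<cdot>\<^sub>v unit_vec p j"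
  let ?r = "\<lambda>a t x. (F a (?u t) x - F a \<theta> x) / t - g a x"
  have r: "?r a t \<in> car (Hm s)" if "a \<in> A" for a t
    using hilbert_fspace_diff[OF Hs hilbert_fspace_closed(3)[OF Hs
        hilbert_fspace_diff[OF Hs F[OF that, of "?u t"] F[OF that \<theta>]], of "1/t"] gm[OF that]] \<theta> by simp
  have "((\<lambda>t. nrm H (\<lambda>z. \<Sum>a\<in>A. c a * tens d ((v a)(s := ?r a t)) z)) \<longlongrightarrow> 0) (at 0)"
  proof (rule nrm_sum_tendsto_0[OF hH])
    fix a assume a: "a \<in> A"
    show "tens d ((v a)(s := ?r a t)) \<in> car H" for t using tens_mem[OF a r[OF a]] .
    have "((\<lambda>t. nrm (Hm s) (?r a t) * sqrt (\<Prod>m\<in>{..<d} - {s}. ip (Hm m) (v a m) (v a m))) \<longlongrightarrow>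
       0 * sqrt (\<Prod>m\<in>{..<d} - {s}. ip (Hm m) (v a m) (v a m))) (at 0)"
      using g[OF a] unfolding has_partial_def by (intro tendsto_intros) auto
    then show "((\<lambda>t. nrm H (tens d ((v a)(s := ?r a t)))) \<longlongrightarrow> 0) (at 0)"
      using nrm_tens_upd[OF H v[OF a] r[OF a] s] by simp
  qed
  \<comment> \<open>Read from right to left: the multivariate error is rewritten as the sum of
    tensors whose norm was just shown to vanish in the limit.\<close>
  moreover have "(\<Sum>a\<in>A. c a * tens d ((v a)(s := ?r a t)) z) =
     ((\<Sum>a\<in>A. c a * tens d ((v a)(s := F a (?u t))) z) - (\<Sum>a\<in>A. c a * tens d ((v a)(s := F a \<theta>)) z)) / t
      - (\<Sum>a\<in>A. c a * tens d ((v a)(s := g a)) z)" for t z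
    unfolding tens_upd[OF s] by (simp add: sum_subtractf[symmetric] sum_divide_distrib algebra_simps diff_divide_distrib)
  ultimately show ?thesis
    unfolding has_partial_def using hilbert_fspace_sum[OF hH, of A] tens_mem gm by simp
qed

section \<open>Square-integrable functions and almost everywhere identities\<close>

lemma L2_add:
  assumes "f \<in> car (L2 M)" "g \<in> car (L2 M)"
  shows "(\<lambda>x. f x + g x) \<in> car (L2 M)"
proof -
  have m: "f \<in> borel_measurable M" "g \<in> borel_measurable M"
    and i: "integrable M (\<lambda>x. (f x)\<^sup>2)" "integrable M (\<lambda>x. (g x)\<^sup>2)"
    using assms by (auto simp: L2_def)
  have "integrable M (\<lambda>x. (f x + g x)\<^sup>2)"
  proof (rule Bochner_Integration.integrable_bound)
    show "integrable M (\<lambda>x. 2 * (f x)\<^sup>2 + 2 * (g x)\<^sup>2)" using i by simp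
    have "(f x + g x)\<^sup>2 \<le> 2 * (f x)\<^sup>2 + 2 * (g x)\<^sup>2" for x
      using sum_squares_ge_zero[of "f x - g x" 0] by (simp add: power2_eq_square algebra_simps)
    then show "AE x in M. norm ((f x + g x)\<^sup>2) \<le> norm (2 * (f x)\<^sup>2 + 2 * (g x)\<^sup>2)" by simp
  qed (use m in measurable)
  then show ?thesis using m by (simp add: L2_def)
qed

lemma L2_scale: "f \<in> car (L2 M) \<Longrightarrow> (\<lambda>x. r * f x) \<in> car (L2 M)"
  by (auto simp: L2_def power_mult_distrib)

lemma L2_diff: "f \<in> car (L2 M) \<Longrightarrow> g \<in> car (L2 M) \<Longrightarrow> (\<lambda>x. f x - g x) \<in> car (L2 M)"
  using L2_add[of f M "\<lambda>x. (-1) * g x"] L2_scale[of g M "-1"] by simp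

lemma L2_sum:
  assumes "\<And>a. a \<in> A \<Longrightarrow> f a \<in> car (L2 M)"
  shows "(\<lambda>x. \<Sum>a\<in>A. f a x) \<in> car (L2 M)"
  using assms
proof (induction A rule: infinite_finite_induct)
  case (insert a A)
  then show ?case using L2_add[of "f a" M "\<lambda>x. \<Sum>a\<in>A. f a x"] by simp
qed (auto simp: L2_def)

lemma nrm_L2_eq_0:
  assumes "f \<in> car (L2 M)" "nrm (L2 M) f = 0"
  shows "AE x in M. f x = 0"
proof -
  have "integrable M (\<lambda>x. (f x)\<^sup>2)" "(\<integral>x. (f x)\<^sup>2 \<partial>M) = 0"
    using assms by (auto simp: L2_def nrm_def power2_eq_square)
  then show ?thesis using integral_nonneg_eq_0_iff_AE[of M "\<lambda>x. (f x)\<^sup>2"] by simp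
qed

lemma eqv_L2_imp_AE:
  assumes "f \<in> car (L2 M)" "g \<in> car (L2 M)" "eqv (L2 M) f g"
  shows "AE x in M. f x = g x"
  using nrm_L2_eq_0[OF L2_diff[OF assms(1,2)]] assms(3) by (simp add: eqv_def)

text \<open>Operators act on representatives; it is the bound \<open>K * 0\<close> that makes them
  respect equality of classes.\<close>

lemma bounded_lin_L2_null:
  assumes T: "bounded_lin X (L2 M) T" and f: "f \<in> car X" "nrm X f = 0"
  shows "AE y in M. T f y = 0"
proof -
  from T f(1) obtain K where "nrm (L2 M) (T f) \<le> K * nrm X f" unfolding bounded_lin_def by blast
  moreover have "T f \<in> car (L2 M)" using T f(1) by (simp add: bounded_lin_def)
  moreover have "0 \<le> nrm (L2 M) (T f)" by (simp add: nrm_def L2_def)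
  ultimately show ?thesis using nrm_L2_eq_0 f(2) by simp
qed

lemma bounded_lin_L2_AE:
  assumes T: "bounded_lin X (L2 M) T" and "f \<in> car X" "g \<in> car X"
  shows "(\<lambda>x. f x + g x) \<in> car X \<Longrightarrow> AE y in M. T (\<lambda>x. f x + g x) y = T f y + T g y"
    and "(\<lambda>x. r * f x) \<in> car X \<Longrightarrow> AE y in M. T (\<lambda>x. r * f x) y = r * T f y"
proof -
  have mem: "T f \<in> car (L2 M)" "T g \<in> car (L2 M)" using assms by (auto simp: bounded_lin_def)
  show "AE y in M. T (\<lambda>x. f x + g x) y = T f y + T g y" if "(\<lambda>x. f x + g x) \<in> car X"
  proof (rule eqv_L2_imp_AE)
    show "T (\<lambda>x. f x + g x) \<in> car (L2 M)" "eqv (L2 M) (T (\<lambda>x. f x + g x)) (\<lambda>y. T f y + T g y)"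
      using T assms(2,3) that unfolding bounded_lin_def by blast+
  qed (rule L2_add[OF mem])
  show "AE y in M. T (\<lambda>x. r * f x) y = r * T f y" if "(\<lambda>x. r * f x) \<in> car X"
  proof (rule eqv_L2_imp_AE)
    show "T (\<lambda>x. r * f x) \<in> car (L2 M)" "eqv (L2 M) (T (\<lambda>x. r * f x)) (\<lambda>y. r * T f y)"
      using T assms(2) that unfolding bounded_lin_def by blast+
  qed (rule L2_scale[OF mem(1)])
qed

section \<open>Lebesgue measure on the open box\<close>

lemma sigma_finite_leb1: "sigma_finite_measure (leb1 S m)"
  unfolding leb1_def
  by (intro sigma_finite_measure_restrict_space lborel.sigma_finite_measure_axioms) simp

lemma product_sigma_finite_leb1: "product_sigma_finite (leb1 S)"
  by (simp add: product_sigma_finite_def sigma_finite_leb1)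

text \<open>The exceptional set lies in a cylinder over a null set. Its measure is a finite product
  with a factor 0, hence 0 even when other factors are infinite.\<close>

lemma (in product_sigma_finite) AE_PiM_component:
  assumes I: "finite I" "i \<in> I" and P: "AE x in M i. P x"
  shows "AE z in PiM I M. P (z i)"
proof -
  from P obtain N where N: "{x \<in> space (M i). \<not> P x} \<subseteq> N" "emeasure (M i) N = 0" "N \<in> sets (M i)"
    by (auto elim: AE_E)
  let ?C = "PiE I (\<lambda>j. if j = i then N else space (M j))"
  have "emeasure (PiM I M) ?C = (\<Prod>j\<in>I. emeasure (M j) (if j = i then N else space (M j)))"
    using I N by (intro emeasure_PiM) auto
  also have "\<dots> = 0" using I N(2) by (auto simp: prod_zero_iff intro!: bexI[of _ i])
  finally have "?C \<in> null_sets (PiM I M)"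
    using I N by (auto intro!: null_setsI sets_PiM_I_finite)
  then show ?thesis
  proof (rule AE_I')
    show "{z \<in> space (PiM I M). \<not> P (z i)} \<subseteq> ?C"
    proof (intro subsetI PiE_I)
      fix z j assume "z \<in> {z \<in> space (PiM I M). \<not> P (z i)}" "j \<in> I"
      then show "z j \<in> (if j = i then N else space (M j))"
        using N(1) by (auto simp: space_PiM PiE_iff)
    qed (auto simp: space_PiM PiE_iff extensional_def)
  qed
qed

text \<open>The square of a product function is the product of the squares, which is integrable by
  Fubini.\<close>

lemma tens_L2:
  assumes M: "product_sigma_finite M" and f: "\<And>m. m < d \<Longrightarrow> f m \<in> car (L2 (M m))"
  shows "tens d f \<in> car (L2 (PiM {..<d} M))"
proof -
  interpret product_sigma_finite M by fact
  have m: "f m \<in> borel_measurable (M m)" "integrable (M m) (\<lambda>x. (f m x)\<^sup>2)" if "m < d" for m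
    using f[OF that] by (auto simp: L2_def)
  have "tens d f \<in> borel_measurable (PiM {..<d} M)"
    unfolding tens_def
  proof (rule borel_measurable_prod)
    fix i assume i: "i \<in> {..<d}"
    show "(\<lambda>z. f i (z i)) \<in> borel_measurable (PiM {..<d} M)"
      using measurable_compose[OF measurable_component_singleton[OF i, of M] m(1)] i by simp
  qed
  moreover have "integrable (PiM {..<d} M) (\<lambda>z. \<Prod>m\<in>{..<d}. (f m (z m))\<^sup>2)"
    by (rule product_integrable_prod) (use m in auto)
  ultimately show ?thesis by (simp add: L2_def tens_def prod_power_distrib)
qed

lemma emeasure_leb1_pos:
  assumes "open U" "x \<in> U" "z_lo S m < x" "x < z_hi S m"
  shows "emeasure (leb1 S m) (U \<inter> {z_lo S m<..<z_hi S m}) \<noteq> 0"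
    and "U \<inter> {z_lo S m<..<z_hi S m} \<in> sets (leb1 S m)"
proof -
  let ?V = "U \<inter> {z_lo S m<..<z_hi S m}"
  have o: "open ?V" "x \<in> ?V" using assms by auto
  have "emeasure (leb1 S m) ?V = emeasure lborel ?V"
    unfolding leb1_def by (rule emeasure_restrict_space) auto
  moreover have "emeasure lborel ?V \<noteq> 0"
  proof
    assume "emeasure lborel ?V = 0"
    then have "?V \<in> null_sets lebesgue" using o(1) by (intro null_setsI) auto
    then have "negligible ?V" by (simp add: negligible_iff_null_sets)
    then show False using open_not_negligible o by blast
  qed
  ultimately show "emeasure (leb1 S m) ?V \<noteq> 0" by simp
  show "?V \<in> sets (leb1 S m)"
    unfolding leb1_def using assms(1) by (auto simp: sets_restrict_space)
qed

text \<open>Open boxes have positive measure, so an almost-everywhere identity between continuous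
  functions holds at every interior point.\<close>

lemma cont_rep_unique_interior:
  assumes h: "cont_rep (leb_D S) (cl_box S (dim_z S)) u h" and g: "cont_rep (leb_D S) (cl_box S (dim_z S)) u g"
    and z: "z \<in> (\<Pi>\<^sub>E m\<in>{..<dim_z S}. {z_lo S m<..<z_hi S m})"
  shows "h z = g z"
proof (rule ccontr)
  assume ne: "h z \<noteq> g z"
  interpret P: product_sigma_finite "leb1 S" by (rule product_sigma_finite_leb1)
  let ?B = "\<Pi>\<^sub>E m\<in>{..<dim_z S}. {z_lo S m<..<z_hi S m}"
  have B: "?B \<subseteq> cl_box S (dim_z S)" unfolding cl_box_def cl1_def by (intro PiE_mono) auto
  have "continuous_on (cl_box S (dim_z S)) (\<lambda>z. h z - g z)"
    using h g by (auto simp: cont_rep_def intro: continuous_on_diff)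
  \<comment> \<open>The set where \<open>h\<close> and \<open>g\<close> differ is open only relative
    to the closed box; \<open>A\<close> is an open set of the whole function space that cuts it
    out.\<close>
  from this[unfolded continuous_on_open_invariant, rule_format, of "- {0}"]
  obtain A where A: "open A" "A \<inter> cl_box S (dim_z S) = (\<lambda>z. h z - g z) -` (- {0}) \<inter> cl_box S (dim_z S)"
    by auto
  have "z \<in> A" using A(2) ne z B by auto
  then obtain X where X: "z \<in> (\<Pi>\<^sub>E i\<in>UNIV. X i)" "\<And>i. open (X i)" "(\<Pi>\<^sub>E i\<in>UNIV. X i) \<subseteq> A"
    using product_topology_open_contains_basis[of "\<lambda>i. euclidean" UNIV A z] A(1)
    by (auto simp: open_fun_def)
  let ?W = "\<Pi>\<^sub>E m\<in>{..<dim_z S}. X m \<inter> {z_lo S m<..<z_hi S m}"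
  have zi: "z m \<in> X m" "z_lo S m < z m" "z m < z_hi S m" if "m < dim_z S" for m
    using X(1) z that by (auto simp: PiE_iff)
  have sets: "?W \<in> sets (leb_D S)"
    unfolding leb_D_def leb_def using emeasure_leb1_pos(2)[OF X(2) zi] by (intro sets_PiM_I_finite) auto
  have "emeasure (leb_D S) ?W = (\<Prod>m<dim_z S. emeasure (leb1 S m) (X m \<inter> {z_lo S m<..<z_hi S m}))"
    unfolding leb_D_def leb_def using emeasure_leb1_pos(2)[OF X(2) zi] by (intro P.emeasure_PiM) auto
  also have "\<dots> \<noteq> 0" using emeasure_leb1_pos(1)[OF X(2) zi] by (auto simp: prod_zero_iff)
  finally have pos: "emeasure (leb_D S) ?W \<noteq> 0" .
  have "w \<in> A \<inter> cl_box S (dim_z S)" if w: "w \<in> ?W" for w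
  proof -
    \<comment> \<open>In coordinates from \<open>dim_z S\<close> on, extensionality makes
      \<open>w\<close> and \<open>z\<close> both \<open>undefined\<close>, so membership in
      \<open>X i\<close> is inherited from \<open>z\<close>.\<close>
    have "w i \<in> X i" for i
    proof (cases "i < dim_z S")
      case False
      then have "w i = z i" using w z by (auto simp: PiE_iff extensional_def)
      then show ?thesis using X(1) by (auto simp: PiE_iff)
    qed (use w in \<open>auto simp: PiE_iff\<close>)
    then have "w \<in> A" using X(3) by (auto simp: PiE_iff)
    moreover have "w \<in> ?B" using w by (auto simp: PiE_iff)
    ultimately show ?thesis using B by blast
  qed
  then have "h w \<noteq> g w" if "w \<in> ?W" for w using A(2) that by auto
  moreover have "AE w in leb_D S. h w = g w"
    using h g unfolding cont_rep_def by (auto elim: AE_mp)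
  ultimately have "AE w in leb_D S. w \<notin> ?W" by (auto elim: AE_mp)
  then have "?W \<in> null_sets (leb_D S)" using sets by (simp add: AE_iff_null_sets)
  then show False using pos by auto
qed

section \<open>Point values of the separable operator\<close>

text \<open>Each use of linearity has its own exceptional null set; a finite sum meets only finitely
  many of them.\<close>

lemma bounded_lin_L2_sum_AE:
  assumes X: "hilbert_fspace N X" and T: "bounded_lin X (L2 M) T"
    and "finite A" "\<And>a. a \<in> A \<Longrightarrow> f a \<in> car X"
  shows "AE y in M. T (\<lambda>x. \<Sum>a\<in>A. c a * f a x) y = (\<Sum>a\<in>A. c a * T (f a) y)"
  using assms(3,4)
proof (induction A rule: finite_induct)
  \<comment> \<open>The image of the zero function need not be identically zero; it vanishes almost
    everywhere because the zero function has norm zero.\<close>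
  case empty
  show ?case
    using bounded_lin_L2_null[OF T hilbert_fspace_closed(1)[OF X] nrm_zero[OF X]] by simp
next
  case (insert a A)
  have fa: "f a \<in> car X" and ca: "(\<lambda>x. c a * f a x) \<in> car X"
    using insert.prems hilbert_fspace_closed(3)[OF X] by auto
  have s: "(\<lambda>x. \<Sum>a\<in>A. c a * f a x) \<in> car X"
    using insert.prems by (intro hilbert_fspace_sum[OF X]) auto
  have "AE y in M. T (\<lambda>x. \<Sum>a\<in>A. c a * f a x) y = (\<Sum>a\<in>A. c a * T (f a) y)"
    using insert by simp
  moreover have "AE y in M. T (\<lambda>x. c a * f a x + (\<Sum>a\<in>A. c a * f a x)) y
      = T (\<lambda>x. c a * f a x) y + T (\<lambda>x. \<Sum>a\<in>A. c a * f a x) y"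
    by (rule bounded_lin_L2_AE(1)[OF T ca s hilbert_fspace_closed(2)[OF X ca s]])
  moreover have "AE y in M. T (\<lambda>x. c a * f a x) y = c a * T (f a) y"
    by (rule bounded_lin_L2_AE(2)[OF T fa fa ca])
  ultimately show ?case by eventually_elim (simp add: insert.hyps)
qed

text \<open>The choice in \<open>cont_eval\<close> does not depend on the point, so all values come
  from a single representative.\<close>

lemma cont_rep_cont_eval: "\<exists>h. cont_rep M C g h \<Longrightarrow> cont_rep M C g (cont_eval M C g)"
  using someI_ex[of "cont_rep M C g"] by (simp add: cont_eval_def[abs_def])

text \<open>The function \<open>h\<close> is allowed to differ from the sum of tensors by a null
  function, because it will be \<open>d_net\<close>, which is known only to that extent.\<close>

lemma eval_D_op_A:
  assumes S: "separable_operator S" and A: "finite A"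
    and v: "\<And>a m. a \<in> A \<Longrightarrow> m < dim_z S \<Longrightarrow> v a m \<in> car (sp_Hm S m)"
    and rep: "\<And>\<beta> a m. \<beta> < rank_A S \<Longrightarrow> a \<in> A \<Longrightarrow> m < dim_z S \<Longrightarrow>
      \<exists>h. cont_rep (leb1 S m) (cl1 S m) (op_Am S \<beta> m (v a m)) h"
    and h: "h \<in> car (sp_H S)" "nrm (sp_H S) (\<lambda>z. h z - (\<Sum>a\<in>A. c a * tens (dim_z S) (v a) z)) = 0"
    and z: "z \<in> (\<Pi>\<^sub>E m\<in>{..<dim_z S}. {z_lo S m<..<z_hi S m})"
  shows "eval_D S (op_A S h) z =
    (\<Sum>\<beta><rank_A S. \<Sum>a\<in>A. c a * (\<Prod>m<dim_z S. eval1 S m (op_Am S \<beta> m (v a m)) (z m)))"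
proof -
  let ?d = "dim_z S" and ?H = "sp_H S" and ?M = "leb_D S"
  let ?g = "\<lambda>z. \<Sum>a\<in>A. c a * tens ?d (v a) z"
  let ?G = "\<lambda>z. \<Sum>\<beta><rank_A S. \<Sum>a\<in>A. c a * (\<Prod>m<?d. eval1 S m (op_Am S \<beta> m (v a m)) (z m))"
  from S obtain T where
    tens_op: "\<And>\<beta>. \<beta> < rank_A S \<Longrightarrow> is_tensor_op ?d ?M (sp_Hm S) ?H (op_Am S \<beta>) (T \<beta>)"
    and opA: "\<And>h. h \<in> car ?H \<Longrightarrow> eqv (L2 ?M) (op_A S h) (\<lambda>z. \<Sum>\<beta><rank_A S. T \<beta> h z)"
    and bA: "bounded_lin (sp_U S) (L2 ?M) (op_A S)" and emb: "car ?H \<subseteq> car (sp_U S)"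
    and tp: "hilbert_tensor_product ?d ?M (sp_Hm S) ?H"
    and bAm: "\<And>\<beta> m. \<beta> < rank_A S \<Longrightarrow> m < ?d \<Longrightarrow> bounded_lin (sp_Hm S m) (L2 (leb1 S m)) (op_Am S \<beta> m)"
    unfolding separable_operator_def embedded_def by blast
  have H: "hilbert_fspace ?M ?H" using tp by (simp add: hilbert_tensor_product_def)
  have bT: "bounded_lin ?H (L2 ?M) (T \<beta>)" if "\<beta> < rank_A S" for \<beta>
    using tens_op[OF that] by (simp add: is_tensor_op_def)
  interpret P: product_sigma_finite "leb1 S" by (rule product_sigma_finite_leb1)
  have tv: "tens ?d (v a) \<in> car ?H" if "a \<in> A" for a
    using tp v[OF that] unfolding hilbert_tensor_product_def by blast
  have g: "?g \<in> car ?H" by (intro hilbert_fspace_sum[OF H] tv)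
  have er: "cont_rep (leb1 S m) (cl1 S m) (op_Am S \<beta> m (v a m)) (eval1 S m (op_Am S \<beta> m (v a m)))"
    if "\<beta> < rank_A S" "a \<in> A" "m < ?d" for \<beta> a m
    using cont_rep_cont_eval[OF rep[OF that]] by (simp add: eval1_def)
  have "AE z in ?M. op_A S h z = (\<Sum>\<beta><rank_A S. T \<beta> h z)"
  proof (rule eqv_L2_imp_AE)
    show "op_A S h \<in> car (L2 ?M)" using bA emb h(1) by (auto simp: bounded_lin_def)
    show "(\<lambda>z. \<Sum>\<beta><rank_A S. T \<beta> h z) \<in> car (L2 ?M)"
      using bT h(1) by (intro L2_sum) (auto simp: bounded_lin_def)
  qed (rule opA[OF h(1)])
  moreover have "AE z in ?M. \<forall>\<beta>\<in>{..<rank_A S}. T \<beta> h z =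
      (\<Sum>a\<in>A. c a * (\<Prod>m<?d. eval1 S m (op_Am S \<beta> m (v a m)) (z m)))"
  proof (rule AE_finite_allI)
    fix \<beta> assume "\<beta> \<in> {..<rank_A S}"
    then have \<beta>: "\<beta> < rank_A S" by simp
    have hg: "(\<lambda>z. h z - ?g z) \<in> car ?H" by (rule hilbert_fspace_diff[OF H h(1) g])
    \<comment> \<open>Writing \<open>h\<close> as \<open>(h - ?g) + ?g\<close> isolates the null
      part, which the operator annihilates almost everywhere.\<close>
    have "AE z in ?M. T \<beta> (\<lambda>z. (h z - ?g z) + ?g z) z = T \<beta> (\<lambda>z. h z - ?g z) z + T \<beta> ?g z"
      by (rule bounded_lin_L2_AE(1)[OF bT[OF \<beta>] hg g hilbert_fspace_closed(2)[OF H hg g]])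
    moreover have "AE z in ?M. T \<beta> (\<lambda>z. h z - ?g z) z = 0"
      by (rule bounded_lin_L2_null[OF bT[OF \<beta>] hg h(2)])
    moreover have "AE z in ?M. T \<beta> ?g z = (\<Sum>a\<in>A. c a * T \<beta> (tens ?d (v a)) z)"
      by (rule bounded_lin_L2_sum_AE[OF H bT[OF \<beta>] A tv])
    moreover have "AE z in ?M. \<forall>a\<in>A. T \<beta> (tens ?d (v a)) z = (\<Prod>m<?d. eval1 S m (op_Am S \<beta> m (v a m)) (z m))"
    proof (rule AE_finite_allI[OF A])
      fix a assume a: "a \<in> A"
      have "AE z in ?M. T \<beta> (tens ?d (v a)) z = tens ?d (\<lambda>m. op_Am S \<beta> m (v a m)) z"
      proof (rule eqv_L2_imp_AE)
        show "T \<beta> (tens ?d (v a)) \<in> car (L2 ?M)" using bT[OF \<beta>] tv[OF a] by (auto simp: bounded_lin_def)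
        show "tens ?d (\<lambda>m. op_Am S \<beta> m (v a m)) \<in> car (L2 ?M)"
          unfolding leb_D_def leb_def
          using bAm[OF \<beta>] v[OF a] by (intro tens_L2 product_sigma_finite_leb1) (auto simp: bounded_lin_def)
        show "eqv (L2 ?M) (T \<beta> (tens ?d (v a))) (tens ?d (\<lambda>m. op_Am S \<beta> m (v a m)))"
          using tens_op[OF \<beta>] v[OF a] unfolding is_tensor_op_def by blast
      qed
      \<comment> \<open>Each univariate representative is correct off a null set of its interval;
        the cylinders over these sets are null in the box.\<close>
      moreover have "AE z in ?M. \<forall>m\<in>{..<?d}. eval1 S m (op_Am S \<beta> m (v a m)) (z m) = op_Am S \<beta> m (v a m) (z m)"
      proof (rule AE_finite_allI)
        fix m assume m: "m \<in> {..<?d}"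
        show "AE z in ?M. eval1 S m (op_Am S \<beta> m (v a m)) (z m) = op_Am S \<beta> m (v a m) (z m)"
          unfolding leb_D_def leb_def
          using P.AE_PiM_component[OF finite_lessThan m] er[OF \<beta> a] m unfolding cont_rep_def by blast
      qed simp
      ultimately show "AE z in ?M. T \<beta> (tens ?d (v a)) z = (\<Prod>m<?d. eval1 S m (op_Am S \<beta> m (v a m)) (z m))"
        by eventually_elim (simp add: tens_def)
    qed
    ultimately show "AE z in ?M. T \<beta> h z = (\<Sum>a\<in>A. c a * (\<Prod>m<?d. eval1 S m (op_Am S \<beta> m (v a m)) (z m)))"
      by eventually_elim simp
  qed simp
  ultimately have "AE z in ?M. ?G z = op_A S h z" by eventually_elim simp
  moreover have "continuous_on (cl_box S ?d) ?G"
  proof (intro continuous_on_sum continuous_on_mult continuous_on_const continuous_on_prod)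
    fix \<beta> a m assume "\<beta> \<in> {..<rank_A S}" "a \<in> A" "m \<in> {..<?d}"
    then have e: "continuous_on (cl1 S m) (eval1 S m (op_Am S \<beta> m (v a m)))"
      and m: "m < ?d" using er by (auto simp: cont_rep_def)
    have "continuous_on (cl_box S ?d) (\<lambda>z. z m)"
      by (rule continuous_on_subset[OF continuous_on_product_coordinates subset_UNIV])
    then show "continuous_on (cl_box S ?d) (\<lambda>z. eval1 S m (op_Am S \<beta> m (v a m)) (z m))"
      by (rule continuous_on_compose2[OF e]) (use m in \<open>auto simp: cl_box_def PiE_iff\<close>)
  qed
  \<comment> \<open>This shows at once that a continuous representative exists, so that the choice
    in \<open>eval_D\<close> is meaningful, and gives a formula to compare it with.\<close>
  ultimately have G: "cont_rep ?M (cl_box S ?d) (op_A S h) ?G" by (simp add: cont_rep_def)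
  then have "cont_rep ?M (cl_box S ?d) (op_A S h) (eval_D S (op_A S h))"
    unfolding eval_D_def by (intro cont_rep_cont_eval exI)
  from cont_rep_unique_interior[OF this G z] show ?thesis .
qed

section \<open>Multi-indices\<close>

lemma lex_pos_less: "is \<in> multi ns \<Longrightarrow> lex_pos ns is < prod_list ns"
  using bij_betw_lex_pos[of ns] by (auto simp: bij_betw_def)

lemma lex_dec_lex_pos: "is \<in> multi ns \<Longrightarrow> lex_dec ns (lex_pos ns is) = is"
  unfolding lex_dec_def using bij_betw_lex_pos[of ns] by (auto simp: bij_betw_def intro: the_inv_into_f_f)

lemma bij_betw_lex_dec: "bij_betw (lex_dec ns) {..<prod_list ns} (multi ns)"
  unfolding lex_dec_def by (rule bij_betw_the_inv_into[OF bij_betw_lex_pos])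

lemma finite_multi: "finite (multi ns)"
  using bij_betw_finite[OF bij_betw_lex_pos[of ns]] by simp

text \<open>Turns the inner index of \<open>Psi_fac * C_fac\<close>, which encodes a pair, into a
  double sum in which the Kronecker delta can be summed out.\<close>

lemma sum_lex_dec_pair: "(\<Sum>q<n * k. f (lex_dec [n, k] q)) = (\<Sum>p<n. \<Sum>b<k. f [p, b])"
proof -
  have "(\<Sum>q<n * k. f (lex_dec [n, k] q)) = sum f (multi [n, k])"
    using sum.reindex_bij_betw[OF bij_betw_lex_dec[of "[n, k]"]] by simp
  also have "multi [n, k] = (\<lambda>(p, b). [p, b]) ` ({..<n} \<times> {..<k})"
    by (auto simp: multi_Cons multi_Nil)
  also have "sum f \<dots> = (\<Sum>(p, b)\<in>{..<n} \<times> {..<k}. f [p, b])"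
    by (subst sum.reindex) (auto simp: inj_on_def intro!: sum.cong)
  finally show ?thesis by (simp add: sum.cartesian_product)
qed

lemma nth_omit:
  assumes "k < length xs - 1" "s < length xs"
  shows "omit s xs ! k = xs ! (if k < s then k else Suc k)"
  using assms by (auto simp: omit_def nth_append)

lemma length_omit: "s < length xs \<Longrightarrow> length (omit s xs) = length xs - 1"
  by (simp add: omit_def)

lemma omit_multi:
  assumes "is \<in> multi ns" "s < length ns"
  shows "omit s is \<in> multi (omit s ns)"
  using assms by (auto simp: multi_def length_omit nth_omit)

lemma prod_list_map_upt: "prod_list (map f [a..<b]) = (\<Prod>m\<in>{a..<b}. f m)"
  using prod.distinct_set_conv_list[of "[a..<b]" f] by simp

lemma prod_list_sizes: "prod_list (sizes S f) = (\<Prod>m<dim_z S. f m)"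
  by (simp add: sizes_def prod_list_map_upt atLeast0LessThan)

text \<open>Matches the number of rows of \<open>E_fac\<close>, a product over a set, with the range
  of \<open>lex_pos\<close> on shortened multi-indices.\<close>

lemma prod_list_omit_sizes:
  assumes "s < dim_z S"
  shows "prod_list (omit s (sizes S f)) = (\<Prod>m\<in>{..<dim_z S} - {s}. f m)"
proof -
  have "{..<dim_z S} - {s} = {0..<s} \<union> {Suc s..<dim_z S}" using assms by auto
  moreover have "omit s (sizes S f) = map f [0..<s] @ map f [Suc s..<dim_z S]"
    using assms by (simp add: omit_def sizes_def take_map drop_map)
  ultimately show ?thesis by (simp add: prod_list_map_upt prod.union_disjoint)
qed

lemma sizes_simps: "length (sizes S f) = dim_z S" "m < dim_z S \<Longrightarrow> sizes S f ! m = f m"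
  by (auto simp: sizes_def)

lemma row_ix_multi: "r < N_D S \<Longrightarrow> row_ix S r \<in> multi (sizes S (npts S))"
  using bij_betw_lex_dec[of "sizes S (npts S)"]
  by (auto simp: row_ix_def N_D_def prod_list_sizes bij_betw_def)

lemma multi_sizes_nth: "a \<in> multi (sizes S f) \<Longrightarrow> m < dim_z S \<Longrightarrow> a ! m < f m"
  by (auto simp: multi_def sizes_simps)

section \<open>The factorization\<close>

context
  fixes S :: setting and \<theta> :: "nat \<Rightarrow> real Matrix.vec"
  assumes op: "separable_operator S" and arch: "separable_architecture S"
    and par: "parameter S \<theta>" and col: "collocation S \<theta>"
begin

lemma feat_car: "m < dim_z S \<Longrightarrow> a < width S m \<Longrightarrow> \<eta> \<in> carrier_vec (npar S m) \<Longrightarrow> feat S m a \<eta> \<in> car (sp_Hm S m)"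
  using arch by (simp add: separable_architecture_def)

lemma theta_carrier: "m < dim_z S \<Longrightarrow> \<theta> m \<in> carrier_vec (npar S m)"
  using par by (simp add: parameter_def)

lemma Hm_hilbert: "m < dim_z S \<Longrightarrow> hilbert_fspace (leb1 S m) (sp_Hm S m)"
  using op by (simp add: separable_operator_def)

lemma H_tensor: "hilbert_tensor_product (dim_z S) (leb_D S) (sp_Hm S) (sp_H S)"
  using op by (simp add: separable_operator_def)

lemma has_partial_d_feat:
  assumes "m < dim_z S" "a < width S m" "j < npar S m"
  shows "has_partial (sp_Hm S m) (npar S m) (feat S m a) (\<theta> m) j (d_feat S \<theta> m a j)"
proof -
  have "frechet_differentiable_at (sp_Hm S m) (npar S m) (feat S m a) (\<theta> m)"
    using arch assms theta_carrier by (simp add: separable_architecture_def)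
  from frechet_differentiable_imp_has_partial[OF Hm_hilbert[OF assms(1)] this
      feat_car[OF assms(1,2)] theta_carrier[OF assms(1)] assms(3)]
  show ?thesis unfolding d_feat_def partial_deriv_def by (rule someI_ex)
qed

text \<open>The parameter block \<open>\<theta> s\<close> enters only factor \<open>s\<close>, so
  the product rule leaves a single tensor for each multi-index.\<close>

definition d_factors :: "nat \<Rightarrow> nat \<Rightarrow> nat list \<Rightarrow> nat \<Rightarrow> real \<Rightarrow> real" where
  "d_factors s j a = (\<lambda>m. feat S m (a ! m) (\<theta> m))(s := d_feat S \<theta> s (a ! s) j)"

text \<open>The explicit sum of tensors is one partial derivative and \<open>d_net\<close> is
  another, chosen by \<open>SOME\<close>; uniqueness up to norm zero compares them.\<close>

lemma d_net_eqv:
  assumes s: "s < dim_z S" and j: "j < npar S s"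
  shows "d_net S \<theta> s j \<in> car (sp_H S)"
    and "nrm (sp_H S) (\<lambda>z. d_net S \<theta> s j z -
      (\<Sum>a\<in>multi (sizes S (width S)). core S a * tens (dim_z S) (d_factors s j a) z)) = 0"
proof -
  let ?A = "multi (sizes S (width S))" and ?H = "sp_H S" and ?d = "dim_z S"
  let ?v = "\<lambda>a m. feat S m (a ! m) (\<theta> m)"
  have H: "hilbert_fspace (leb_D S) ?H" using H_tensor by (simp add: hilbert_tensor_product_def)
  have net: "net S (\<theta>(s := \<eta>)) = (\<lambda>z. \<Sum>a\<in>?A. core S a * tens ?d ((?v a)(s := feat S s (a ! s) \<eta>)) z)" for \<eta>
  proof -
    have "(\<lambda>m. feat S m (a ! m) ((\<theta>(s := \<eta>)) m)) = (?v a)(s := feat S s (a ! s) \<eta>)" for a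
      by (rule ext) simp
    then show ?thesis unfolding net_def by simp
  qed
  have P: "has_partial ?H (npar S s) (\<lambda>\<eta>. net S (\<theta>(s := \<eta>))) (\<theta> s) j
     (\<lambda>z. \<Sum>a\<in>?A. core S a * tens ?d (d_factors s j a) z)"
    unfolding net d_factors_def
  proof (rule has_partial_sum_tens[OF H_tensor Hm_hilbert[OF s] _ _ _ s theta_carrier[OF s]])
    fix a assume a: "a \<in> ?A"
    show "?v a m \<in> car (sp_Hm S m)" if "m < ?d" for m
      using feat_car[OF that multi_sizes_nth[OF a that] theta_carrier[OF that]] .
    show "feat S s (a ! s) \<eta> \<in> car (sp_Hm S s)" if "\<eta> \<in> carrier_vec (npar S s)" for \<eta>
      using feat_car[OF s multi_sizes_nth[OF a s] that] .
    show "has_partial (sp_Hm S s) (npar S s) (feat S s (a ! s)) (\<theta> s) j (d_feat S \<theta> s (a ! s) j)"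
      using has_partial_d_feat[OF s multi_sizes_nth[OF a s] j] .
  qed
  then have "\<exists>g. has_partial ?H (npar S s) (\<lambda>\<eta>. net S (\<theta>(s := \<eta>))) (\<theta> s) j g" by blast
  then have Q: "has_partial ?H (npar S s) (\<lambda>\<eta>. net S (\<theta>(s := \<eta>))) (\<theta> s) j (d_net S \<theta> s j)"
    unfolding d_net_def partial_deriv_def by (rule someI_ex)
  then show "d_net S \<theta> s j \<in> car ?H" by (simp add: has_partial_def)
  have netH: "net S (\<theta>(s := \<eta>)) \<in> car ?H" if "\<eta> \<in> carrier_vec (npar S s)" for \<eta>
    unfolding net
  proof (rule hilbert_fspace_sum[OF H])
    fix a assume a: "a \<in> ?A"
    have "((?v a)(s := feat S s (a ! s) \<eta>)) m \<in> car (sp_Hm S m)" if "m < ?d" for m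
      using feat_car[OF that multi_sizes_nth[OF a that]] theta_carrier[OF that] \<open>\<eta> \<in> _\<close> by auto
    then show "tens ?d ((?v a)(s := feat S s (a ! s) \<eta>)) \<in> car ?H"
      using H_tensor unfolding hilbert_tensor_product_def by blast
  qed
  show "nrm ?H (\<lambda>z. d_net S \<theta> s j z - (\<Sum>a\<in>?A. core S a * tens ?d (d_factors s j a) z)) = 0"
    by (rule has_partial_unique[OF H Q P netH theta_carrier[OF s]])
qed

lemma grid_interior: "r < N_D S \<Longrightarrow> grid S r \<in> (\<Pi>\<^sub>E m\<in>{..<dim_z S}. {z_lo S m<..<z_hi S m})"
  using col row_ix_multi[of r S] multi_sizes_nth[of "row_ix S r" S "npts S"]
  by (auto simp: grid_def collocation_def PiE_iff)

text \<open>Factor \<open>s\<close> is kept apart because it becomes an entry of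
  \<open>C_fac\<close>, while the other factors are collected in \<open>E_fac\<close>.\<close>

lemma Jac_entry:
  assumes s: "s < dim_z S" and r: "r < N_D S" and j: "j < npar S s"
  shows "Jac S \<theta> s $$ (r, j) = (\<Sum>\<beta><rank_A S. \<Sum>a\<in>multi (sizes S (width S)). core S a *
    (eval1 S s (op_Am S \<beta> s (d_feat S \<theta> s (a ! s) j)) (pts S s (row_ix S r ! s)) *
     (\<Prod>m\<in>{..<dim_z S} - {s}. eval1 S m (op_Am S \<beta> m (feat S m (a ! m) (\<theta> m))) (pts S m (row_ix S r ! m)))))"
proof -
  let ?A = "multi (sizes S (width S))" and ?d = "dim_z S"
  have "Jac S \<theta> s $$ (r, j) = eval_D S (op_A S (d_net S \<theta> s j)) (grid S r)"
    using r j by (simp add: Jac_def)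
  also have "\<dots> = (\<Sum>\<beta><rank_A S. \<Sum>a\<in>?A. core S a *
      (\<Prod>m<?d. eval1 S m (op_Am S \<beta> m (d_factors s j a m)) (grid S r m)))"
  proof (rule eval_D_op_A[OF op finite_multi _ _ d_net_eqv[OF s j] grid_interior[OF r]])
    fix a m assume a: "a \<in> ?A" and m: "m < ?d"
    note am = multi_sizes_nth[OF a m]
    show "d_factors s j a m \<in> car (sp_Hm S m)"
      using feat_car[OF m am theta_carrier[OF m]] has_partial_d_feat[OF m am] j
      by (auto simp: d_factors_def has_partial_def)
    show "\<exists>h. cont_rep (leb1 S m) (cl1 S m) (op_Am S \<beta> m (d_factors s j a m)) h" if "\<beta> < rank_A S" for \<beta>
      using col that m am j by (auto simp: collocation_def d_factors_def)
  qed
  also have "\<dots> = (\<Sum>\<beta><rank_A S. \<Sum>a\<in>?A. core S a *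
    (eval1 S s (op_Am S \<beta> s (d_feat S \<theta> s (a ! s) j)) (pts S s (row_ix S r ! s)) *
     (\<Prod>m\<in>{..<?d} - {s}. eval1 S m (op_Am S \<beta> m (feat S m (a ! m) (\<theta> m))) (pts S m (row_ix S r ! m)))))"
  proof (intro sum.cong refl arg_cong2[where f="(*)"])
    fix \<beta> a
    show "(\<Prod>m<?d. eval1 S m (op_Am S \<beta> m (d_factors s j a m)) (grid S r m)) =
      eval1 S s (op_Am S \<beta> s (d_feat S \<theta> s (a ! s) j)) (pts S s (row_ix S r ! s)) *
     (\<Prod>m\<in>{..<?d} - {s}. eval1 S m (op_Am S \<beta> m (feat S m (a ! m) (\<theta> m))) (pts S m (row_ix S r ! m)))"
      using s by (subst prod.remove[of _ s]) (auto simp: d_factors_def grid_def intro!: prod.cong)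
  qed
  finally show ?thesis .
qed

end

text \<open>Decoding the row number returns the shortened multi-index, and the shift by one beyond
  place \<open>s\<close> undoes the omission.\<close>

lemma E_fac_entry:
  assumes s: "s < dim_z S" and r: "r < N_D S" and b: "b < width S s"
  shows "E_fac S \<theta> s \<beta> $$ (lex_pos (omit s (sizes S (npts S))) (omit s (row_ix S r)), b) =
    (\<Sum>a\<in>{a \<in> multi (sizes S (width S)). a ! s = b}. core S a *
      (\<Prod>m\<in>{..<dim_z S} - {s}. eval1 S m (op_Am S \<beta> m (feat S m (a ! m) (\<theta> m))) (pts S m (row_ix S r ! m))))"
proof -
  let ?i = "row_ix S r"
  have i: "?i \<in> multi (sizes S (npts S))" by (rule row_ix_multi[OF r])
  then have len: "length ?i = dim_z S" by (simp add: multi_def sizes_simps)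
  have o: "omit s ?i \<in> multi (omit s (sizes S (npts S)))"
    using omit_multi[OF i] s by (simp add: sizes_simps)
  \<comment> \<open>Entries of \<open>Matrix.mat\<close> are specified only within its dimensions,
    so the row number needs this bound.\<close>
  have lt: "lex_pos (omit s (sizes S (npts S))) (omit s ?i) < (\<Prod>m\<in>{..<dim_z S} - {s}. npts S m)"
    using lex_pos_less[OF o] prod_list_omit_sizes[OF s, of "npts S"] by simp
  have nth: "omit s ?i ! (if m < s then m else m - 1) = ?i ! m" if "m \<in> {..<dim_z S} - {s}" for m
    using that s len by (subst nth_omit) auto
  have "E_fac S \<theta> s \<beta> $$ (lex_pos (omit s (sizes S (npts S))) (omit s ?i), b) =
    (\<Sum>a\<in>{a \<in> multi (sizes S (width S)). a ! s = b}. core S a *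
      (\<Prod>m\<in>{..<dim_z S} - {s}. eval1 S m (op_Am S \<beta> m (feat S m (a ! m) (\<theta> m)))
        (pts S m (omit s ?i ! (if m < s then m else m - 1)))))"
    using lt b by (simp add: E_fac_def lex_dec_lex_pos[OF o] Let_def)
  then show ?thesis by (simp only: nth cong: prod.cong)
qed

lemma Psi_fac_mult_C_fac_entry:
  assumes s: "s < dim_z S" and r: "r < N_D S" and j: "j < npar S s"
  shows "(Psi_fac S \<theta> s \<beta> * C_fac S \<theta> s \<beta>) $$ (r, j) = (\<Sum>a\<in>multi (sizes S (width S)). core S a *
    (eval1 S s (op_Am S \<beta> s (d_feat S \<theta> s (a ! s) j)) (pts S s (row_ix S r ! s)) *
     (\<Prod>m\<in>{..<dim_z S} - {s}. eval1 S m (op_Am S \<beta> m (feat S m (a ! m) (\<theta> m))) (pts S m (row_ix S r ! m)))))"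
    (is "_ = (\<Sum>a\<in>?A. ?t a)")
proof -
  let ?n = "npts S s" and ?k = "width S s" and ?i = "row_ix S r"
  let ?E = "\<lambda>b. E_fac S \<theta> s \<beta> $$ (lex_pos (omit s (sizes S (npts S))) (omit s ?i), b)"
  let ?C = "\<lambda>p b. eval1 S s (op_Am S \<beta> s (d_feat S \<theta> s b j)) (pts S s p)"
  have "?i \<in> multi (sizes S (npts S))" by (rule row_ix_multi[OF r])
  then have is_n: "?i ! s < ?n" by (rule multi_sizes_nth) (rule s)
  have "(Psi_fac S \<theta> s \<beta> * C_fac S \<theta> s \<beta>) $$ (r, j) =
      (\<Sum>q<?n * ?k. Psi_fac S \<theta> s \<beta> $$ (r, q) * C_fac S \<theta> s \<beta> $$ (q, j))"
    using r j by (simp add: Psi_fac_def C_fac_def scalar_prod_def atLeast0LessThan)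
  also have "\<dots> = (\<Sum>q<?n * ?k. (\<lambda>ja. (if ?i ! s = ja ! 0 then ?E (ja ! 1) else 0) * ?C (ja ! 0) (ja ! 1)) (lex_dec [?n, ?k] q))"
    using r j by (intro sum.cong refl) (simp add: Psi_fac_def C_fac_def Let_def)
  also have "\<dots> = (\<Sum>p<?n. \<Sum>b<?k. (if ?i ! s = p then ?E b else 0) * ?C p b)"
    by (subst sum_lex_dec_pair) (auto intro!: sum.cong)
  \<comment> \<open>The delta in \<open>Psi_fac\<close> keeps only the collocation index of row
    \<open>r\<close> in direction \<open>s\<close>.\<close>
  also have "\<dots> = (\<Sum>p<?n. if p = ?i ! s then \<Sum>b<?k. ?E b * ?C p b else 0)"
    by (intro sum.cong refl) auto
  also have "\<dots> = (\<Sum>b<?k. ?E b * ?C (?i ! s) b)"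
    using is_n by simp
  \<comment> \<open>In the sum defining \<open>?E b\<close> the entry \<open>a ! s\<close> equals
    \<open>b\<close>, so \<open>b\<close> can be replaced by it in the factor from
    \<open>C_fac\<close>.\<close>
  also have "\<dots> = (\<Sum>b<?k. \<Sum>a\<in>{a \<in> ?A. a ! s = b}. ?t a)"
    by (intro sum.cong refl) (auto simp: E_fac_entry[OF s r] sum_distrib_left sum_distrib_right mult_ac intro!: sum.cong)
  \<comment> \<open>The fibres of \<open>a ! s\<close> over \<open>b < ?k\<close> exhaust the
    multi-indices.\<close>
  also have "\<dots> = (\<Sum>a\<in>?A. ?t a)"
    using s by (intro sum.group finite_multi) (auto intro: multi_sizes_nth)
  finally show ?thesis .
qed

section \<open>Dimensions and products of the assembled matrices\<close>

lemma Psi_fac_carrier: "Psi_fac S \<theta> s \<beta> \<in> carrier_mat (N_D S) (npts S s * width S s)"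
  by (simp add: Psi_fac_def)

lemma C_fac_carrier: "C_fac S \<theta> s \<beta> \<in> carrier_mat (npts S s * width S s) (npar S s)"
  by (simp add: C_fac_def)

lemma Psi_blk_carrier: "Psi_blk S \<theta> s \<in> carrier_mat (N_D S) (N_s S s)"
  using hcat_map_carrier[of "rank_A S" "Psi_fac S \<theta> s", OF Psi_fac_carrier]
  by (simp add: Psi_blk_def N_s_def mult.assoc)

lemma C_blk_carrier: "C_blk S \<theta> s \<in> carrier_mat (N_s S s) (npar S s)"
  using vcat_map_carrier[of "rank_A S" "C_fac S \<theta> s", OF C_fac_carrier]
  by (simp add: C_blk_def N_s_def mult.assoc)

lemma Psi_carrier: "Psi S \<theta> \<in> carrier_mat (N_D S) (N_eff S)"
  unfolding Psi_def N_eff_def by (intro hcat_map_carrier Psi_blk_carrier)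

lemma C_diag_carrier: "C_diag S \<theta> \<in> carrier_mat (N_eff S) (N_par S)"
proof -
  have "map dim_row (map (C_blk S \<theta>) [0..<dim_z S]) = map (N_s S) [0..<dim_z S]"
    "map dim_col (map (C_blk S \<theta>) [0..<dim_z S]) = map (npar S) [0..<dim_z S]"
    using C_blk_carrier by fastforce+
  then show ?thesis
    using dim_diag_block_mat[of "map (C_blk S \<theta>) [0..<dim_z S]"]
    unfolding C_diag_def N_eff_def N_par_def
    by (intro carrier_matI) (simp_all add: interv_sum_list_conv_sum_set_nat atLeast0LessThan)
qed

lemma Jac_carrier: "Jac S \<theta> s \<in> carrier_mat (N_D S) (npar S s)"
  by (simp add: Jac_def)

lemma J_rho_carrier: "J_rho S \<theta> \<in> carrier_mat (N_D S) (N_par S)"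
  unfolding J_rho_def N_par_def by (intro hcat_map_carrier Jac_carrier)

lemma resid_carrier: "resid S \<theta> \<in> carrier_vec (N_D S)"
  by (simp add: resid_def)

lemma Jac_eq_Psi_blk_mult_C_blk:
  assumes S: "separable_operator S" "separable_architecture S" "parameter S \<theta>" "collocation S \<theta>"
    and s: "s < dim_z S"
  shows "Jac S \<theta> s = Psi_blk S \<theta> s * C_blk S \<theta> s"
proof (rule eq_matI)
  show d: "dim_row (Jac S \<theta> s) = dim_row (Psi_blk S \<theta> s * C_blk S \<theta> s)"
    "dim_col (Jac S \<theta> s) = dim_col (Psi_blk S \<theta> s * C_blk S \<theta> s)"
    using Jac_carrier[of S \<theta> s] Psi_blk_carrier[of S \<theta> s] C_blk_carrier[of S \<theta> s] by auto
  fix r j assume "r < dim_row (Psi_blk S \<theta> s * C_blk S \<theta> s)" "j < dim_col (Psi_blk S \<theta> s * C_blk S \<theta> s)"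
  then have rj: "r < N_D S" "j < npar S s" using d Jac_carrier[of S \<theta> s] by auto
  have "(Psi_blk S \<theta> s * C_blk S \<theta> s) $$ (r, j) = (\<Sum>\<beta>\<leftarrow>[0..<rank_A S]. (Psi_fac S \<theta> s \<beta> * C_fac S \<theta> s \<beta>) $$ (r, j))"
    unfolding Psi_blk_def C_blk_def
    by (rule hcat_mult_vcat_index[OF Psi_fac_carrier C_fac_carrier rj])
  also have "\<dots> = (\<Sum>\<beta><rank_A S. (Psi_fac S \<theta> s \<beta> * C_fac S \<theta> s \<beta>) $$ (r, j))"
    by (simp only: interv_sum_list_conv_sum_set_nat set_upt atLeast0LessThan)
  also have "\<dots> = Jac S \<theta> s $$ (r, j)"
    unfolding Jac_entry[OF S s rj] Psi_fac_mult_C_fac_entry[OF s rj] ..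
  finally show "Jac S \<theta> s $$ (r, j) = (Psi_blk S \<theta> s * C_blk S \<theta> s) $$ (r, j)" ..
qed

lemma scaled_gram_mult:
  assumes A: "A \<in> carrier_mat (N_D S) n" and B: "B \<in> carrier_mat (N_D S) m"
    and C: "C \<in> carrier_mat n p" and D: "D \<in> carrier_mat m q"
  shows "scaled_gram S (A * C) (B * D) = transpose_mat C * scaled_gram S A B * D"
proof -
  have t: "transpose_mat A \<in> carrier_mat n (N_D S)" "transpose_mat C \<in> carrier_mat p n" using A C by auto
  have AB: "transpose_mat A * B \<in> carrier_mat n m" using t B by simp
  have "transpose_mat (A * C) * (B * D) = transpose_mat C * transpose_mat A * (B * D)"
    using transpose_mult[OF A C] by simp
  also have "\<dots> = transpose_mat C * (transpose_mat A * (B * D))"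
    using t B D by (intro assoc_mult_mat) auto
  also have "transpose_mat A * (B * D) = transpose_mat A * B * D"
    using assoc_mult_mat[OF t(1) B D] ..
  also have "transpose_mat C * (transpose_mat A * B * D) = transpose_mat C * (transpose_mat A * B) * D"
    using assoc_mult_mat[OF t(2) AB D] ..
  finally have e: "transpose_mat (A * C) * (B * D) = transpose_mat C * (transpose_mat A * B) * D" .
  show ?thesis unfolding scaled_gram_def e
    using mult_smult_distrib[OF t(2) AB] mult_smult_assoc_mat[OF mult_carrier_mat[OF t(2) AB] D] by simp
qed

lemma transpose_mult_vec_scale:
  assumes A: "A \<in> carrier_mat nr n" and C: "C \<in> carrier_mat n p" and x: "x \<in> carrier_vec nr"
  shows "c \<cdot>\<^sub>v (transpose_mat (A * C) *\<^sub>v x) = transpose_mat C *\<^sub>v (c \<cdot>\<^sub>v (transpose_mat A *\<^sub>v (x :: real Matrix.vec)))"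
proof -
  have t: "transpose_mat A \<in> carrier_mat n nr" "transpose_mat C \<in> carrier_mat p n" using A C by auto
  have "transpose_mat (A * C) *\<^sub>v x = transpose_mat C *\<^sub>v (transpose_mat A *\<^sub>v x)"
    using transpose_mult[OF A C] assoc_mult_mat_vec[OF t(2,1) x] by simp
  then show ?thesis using mult_mat_vec[OF t(2), of "transpose_mat A *\<^sub>v x" c] t x by simp
qed

lemma scaled_gram_hcat:
  assumes "\<And>s. s < p \<Longrightarrow> f s \<in> carrier_mat (N_D S) (ht s)" "\<And>t. t < q \<Longrightarrow> g t \<in> carrier_mat (N_D S) (wd t)"
  shows "scaled_gram S (hcat (N_D S) (map f [0..<p])) (hcat (N_D S) (map g [0..<q])) =
    block_matrix p q ht wd (\<lambda>s t. scaled_gram S (f s) (g t))"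
  unfolding scaled_gram_def transpose_hcat map_map
  using block_matrix_mult[of p "\<lambda>s. transpose_mat (f s)" ht "N_D S" q g wd] assms by (simp add: comp_def)

lemma transpose_hcat_mult_vec:
  assumes "\<And>s. s < p \<Longrightarrow> f s \<in> carrier_mat nr (wd s)"
  shows "c \<cdot>\<^sub>v (transpose_mat (hcat nr (map f [0..<p])) *\<^sub>v x) =
    vstack (map (\<lambda>s. c \<cdot>\<^sub>v (transpose_mat (f s) *\<^sub>v x)) [0..<p])"
  unfolding transpose_hcat using assms[THEN carrier_matD(1)]
  by (subst smult_vcat_mult_vec) (auto simp: comp_def)

lemma scaled_gram_carrier:
  "A \<in> carrier_mat (N_D S) n \<Longrightarrow> B \<in> carrier_mat (N_D S) m \<Longrightarrow> scaled_gram S A B \<in> carrier_mat n m"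
  by (simp add: scaled_gram_def)

lemma scaled_transpose_mult_vec_carrier:
  "A \<in> carrier_mat nr n \<Longrightarrow> c \<cdot>\<^sub>v (transpose_mat A *\<^sub>v x) \<in> carrier_vec n"
  by (simp add: carrier_vecI)

theorem theorem2p10:
  fixes S :: setting and \<theta> :: "nat \<Rightarrow> real Matrix.vec"
  assumes "separable_domain S"
    and "separable_operator S"
    and "separable_architecture S"
    and "parameter S \<theta>"
    and "collocation S \<theta>"
  shows
    "(J_rho S \<theta> \<in> carrier_mat (N_D S) (N_par S) \<and>
     Psi S \<theta> \<in> carrier_mat (N_D S) (N_eff S) \<and>
     C_diag S \<theta> \<in> carrier_mat (N_eff S) (N_par S) \<and>
     (\<forall>s<dim_z S. Psi_blk S \<theta> s \<in> carrier_mat (N_D S) (N_s S s) \<and>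
        C_blk S \<theta> s \<in> carrier_mat (N_s S s) (npar S s)) \<and>
     J_rho S \<theta> = Psi S \<theta> * C_diag S \<theta> \<and>
     N_eff S = rank_A S * (\<Sum>s<dim_z S. npts S s * width S s)) \<and>
     (Upsilon S \<theta> = block_matrix (dim_z S) (dim_z S) (N_s S) (N_s S) (Upsilon_blk S \<theta>) \<and>
     (\<forall>s<dim_z S. \<forall>t<dim_z S.
        Upsilon_blk S \<theta> s t \<in> carrier_mat (N_s S s) (N_s S t) \<and>
        Upsilon_blk S \<theta> s t =
          block_matrix (rank_A S) (rank_A S)
            (\<lambda>_. npts S s * width S s) (\<lambda>_. npts S t * width S t) (Upsilon_fac S \<theta> s t) \<and>
        (\<forall>\<beta><rank_A S. \<forall>\<gamma><rank_A S. Upsilon_fac S \<theta> s t \<beta> \<gamma>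
          \<in> carrier_mat (npts S s * width S s) (npts S t * width S t))) \<and>
     Gram S \<theta> = block_matrix (dim_z S) (dim_z S) (npar S) (npar S) (Gram_blk S \<theta>) \<and>
     Gram S \<theta> = transpose_mat (C_diag S \<theta>) * Upsilon S \<theta> * C_diag S \<theta> \<and>
     (\<forall>s<dim_z S. \<forall>t<dim_z S.
        Gram_blk S \<theta> s t = transpose_mat (C_blk S \<theta> s) * Upsilon_blk S \<theta> s t * C_blk S \<theta> t) \<and>
     mrank (Gram S \<theta>) = mrank (J_rho S \<theta>) \<and>
     mrank (J_rho S \<theta>) \<le> Min {N_D S, N_eff S, N_par S}) \<and>
     (rho_c S \<theta> \<in> carrier_vec (N_eff S) \<and>
     rho_c S \<theta> = vstack (map (rho_c_blk S \<theta>) [0..<dim_z S]) \<and>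
     (\<forall>s<dim_z S. rho_c_blk S \<theta> s \<in> carrier_vec (N_s S s) \<and>
        rho_c_blk S \<theta> s = vstack (map (rho_c_fac S \<theta> s) [0..<rank_A S]) \<and>
        (\<forall>\<beta><rank_A S. rho_c_fac S \<theta> s \<beta> \<in> carrier_vec (npts S s * width S s))) \<and>
     grad_loss S \<theta> = vstack (map (grad_loss_block S \<theta>) [0..<dim_z S]) \<and>
     grad_loss S \<theta> = transpose_mat (C_diag S \<theta>) *\<^sub>v rho_c S \<theta> \<and>
     (\<forall>s<dim_z S. grad_loss_block S \<theta> s = transpose_mat (C_blk S \<theta> s) *\<^sub>v rho_c_blk S \<theta> s))"
proof -
  \<comment> \<open>Every direction has a collocation point; the rank identity needs the scalar
    \<open>1 / real (N_D S)\<close> to be nonzero.\<close>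
  have N_D: "N_D S > 0" using assms(5) by (auto simp: N_D_def collocation_def intro!: prod_pos)
  have Jb: "Jac S \<theta> s = Psi_blk S \<theta> s * C_blk S \<theta> s" if "s < dim_z S" for s
    by (rule Jac_eq_Psi_blk_mult_C_blk[OF assms(2-5) that])
  have J: "J_rho S \<theta> = Psi S \<theta> * C_diag S \<theta>"
  proof -
    have "Psi S \<theta> * C_diag S \<theta> = hcat (N_D S) (map (\<lambda>s. Psi_blk S \<theta> s * C_blk S \<theta> s) [0..<dim_z S])"
      unfolding Psi_def C_diag_def
      by (rule hcat_mult_diag_block_mat[OF Psi_blk_carrier C_blk_carrier])
    also have "map (\<lambda>s. Psi_blk S \<theta> s * C_blk S \<theta> s) [0..<dim_z S] = map (Jac S \<theta>) [0..<dim_z S]"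
      using Jb by simp
    finally show ?thesis by (simp add: J_rho_def)
  qed
  have N_eff: "N_eff S = rank_A S * (\<Sum>s<dim_z S. npts S s * width S s)"
    by (simp add: N_eff_def N_s_def sum_distrib_left mult.assoc)
  have U: "Upsilon S \<theta> = block_matrix (dim_z S) (dim_z S) (N_s S) (N_s S) (Upsilon_blk S \<theta>)"
    unfolding Upsilon_def Upsilon_blk_def Psi_def
    using scaled_gram_hcat[of "dim_z S" "Psi_blk S \<theta>" S "N_s S" "dim_z S" "Psi_blk S \<theta>" "N_s S", OF Psi_blk_carrier Psi_blk_carrier] .
  have Ub: "Upsilon_blk S \<theta> s t \<in> carrier_mat (N_s S s) (N_s S t)"
    "Upsilon_blk S \<theta> s t = block_matrix (rank_A S) (rank_A S)
       (\<lambda>_. npts S s * width S s) (\<lambda>_. npts S t * width S t) (Upsilon_fac S \<theta> s t)"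
    "Upsilon_fac S \<theta> s t \<beta> \<gamma> \<in> carrier_mat (npts S s * width S s) (npts S t * width S t)" for s t \<beta> \<gamma>
  proof -
    show "Upsilon_blk S \<theta> s t \<in> carrier_mat (N_s S s) (N_s S t)"
      unfolding Upsilon_blk_def by (rule scaled_gram_carrier[OF Psi_blk_carrier Psi_blk_carrier])
    show "Upsilon_fac S \<theta> s t \<beta> \<gamma> \<in> carrier_mat (npts S s * width S s) (npts S t * width S t)"
      unfolding Upsilon_fac_def by (rule scaled_gram_carrier[OF Psi_fac_carrier Psi_fac_carrier])
    show "Upsilon_blk S \<theta> s t = block_matrix (rank_A S) (rank_A S)
       (\<lambda>_. npts S s * width S s) (\<lambda>_. npts S t * width S t) (Upsilon_fac S \<theta> s t)"
      unfolding Upsilon_blk_def Upsilon_fac_def Psi_blk_def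
      using scaled_gram_hcat[of "rank_A S" "Psi_fac S \<theta> s" S "\<lambda>_. npts S s * width S s" "rank_A S" "Psi_fac S \<theta> t"
          "\<lambda>_. npts S t * width S t", OF Psi_fac_carrier Psi_fac_carrier] .
  qed
  have G: "Gram S \<theta> = block_matrix (dim_z S) (dim_z S) (npar S) (npar S) (Gram_blk S \<theta>)"
    unfolding Gram_def Gram_blk_def J_rho_def
    using scaled_gram_hcat[of "dim_z S" "Jac S \<theta>" S "npar S" "dim_z S" "Jac S \<theta>" "npar S", OF Jac_carrier Jac_carrier] .
  have GC: "Gram S \<theta> = transpose_mat (C_diag S \<theta>) * Upsilon S \<theta> * C_diag S \<theta>"
    unfolding Gram_def Upsilon_def J
    by (rule scaled_gram_mult[OF Psi_carrier Psi_carrier C_diag_carrier C_diag_carrier])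
  have GbC: "Gram_blk S \<theta> s t = transpose_mat (C_blk S \<theta> s) * Upsilon_blk S \<theta> s t * C_blk S \<theta> t"
    if "s < dim_z S" "t < dim_z S" for s t
    unfolding Gram_blk_def Upsilon_blk_def Jb[OF that(1)] Jb[OF that(2)]
    by (rule scaled_gram_mult[OF Psi_blk_carrier Psi_blk_carrier C_blk_carrier C_blk_carrier])
  have rk: "mrank (Gram S \<theta>) = mrank (J_rho S \<theta>)"
    unfolding Gram_def scaled_gram_def using N_D by (intro mrank_gram[OF J_rho_carrier]) simp
  have "mrank (J_rho S \<theta>) \<le> N_D S" "mrank (J_rho S \<theta>) \<le> N_par S"
    using mrank_le_dim_row[of "J_rho S \<theta>"] mrank_le_dim_col[of "J_rho S \<theta>"] J_rho_carrier[of S \<theta>] by auto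
  \<comment> \<open>The factorization passes through \<open>Psi\<close>, which has
    \<open>N_eff S\<close> columns.\<close>
  moreover have "mrank (J_rho S \<theta>) \<le> N_eff S"
    using mrank_mult_le[OF Psi_carrier C_diag_carrier, of S \<theta> \<theta>] mrank_le_dim_col[of "Psi S \<theta>"]
      Psi_carrier[of S \<theta>] unfolding J by auto
  ultimately have rk_le: "mrank (J_rho S \<theta>) \<le> Min {N_D S, N_eff S, N_par S}" by simp
  have rc: "rho_c S \<theta> \<in> carrier_vec (N_eff S)" "rho_c_blk S \<theta> s \<in> carrier_vec (N_s S s)"
    "rho_c_fac S \<theta> s \<beta> \<in> carrier_vec (npts S s * width S s)" for s \<beta>
    unfolding rho_c_def rho_c_blk_def rho_c_fac_def
    by (rule scaled_transpose_mult_vec_carrier[OF Psi_carrier]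
        scaled_transpose_mult_vec_carrier[OF Psi_blk_carrier]
        scaled_transpose_mult_vec_carrier[OF Psi_fac_carrier])+
  have rcs: "rho_c S \<theta> = vstack (map (rho_c_blk S \<theta>) [0..<dim_z S])"
    "rho_c_blk S \<theta> s = vstack (map (rho_c_fac S \<theta> s) [0..<rank_A S])"
    "grad_loss S \<theta> = vstack (map (grad_loss_block S \<theta>) [0..<dim_z S])" for s
    unfolding rho_c_def rho_c_blk_def[abs_def] rho_c_fac_def[abs_def] grad_loss_def grad_loss_block_def[abs_def]
      Psi_def J_rho_def
    \<comment> \<open>\<open>Psi_blk\<close> stays folded in the first equation, where it is a
      block, and is unfolded in the second, where it is the concatenation.\<close>
    by (rule transpose_hcat_mult_vec[OF Psi_blk_carrier])
      (unfold Psi_blk_def, rule transpose_hcat_mult_vec[OF Psi_fac_carrier],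
        rule transpose_hcat_mult_vec[OF Jac_carrier])
  have gl: "grad_loss S \<theta> = transpose_mat (C_diag S \<theta>) *\<^sub>v rho_c S \<theta>"
    unfolding grad_loss_def rho_c_def J
    by (rule transpose_mult_vec_scale[OF Psi_carrier C_diag_carrier resid_carrier])
  have glb: "grad_loss_block S \<theta> s = transpose_mat (C_blk S \<theta> s) *\<^sub>v rho_c_blk S \<theta> s" if "s < dim_z S" for s
    unfolding grad_loss_block_def rho_c_blk_def Jb[OF that]
    by (rule transpose_mult_vec_scale[OF Psi_blk_carrier C_blk_carrier resid_carrier])
  show ?thesis
    by (intro conjI allI impI J_rho_carrier Psi_carrier C_diag_carrier Psi_blk_carrier C_blk_carrier
        J N_eff U Ub G GC GbC rk rk_le rc rcs gl glb)
qed

end
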